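(* Let $\lambda\in\mathbb{P}^1=\mathbb{C}\cup\{\infty\}$. Then the second cohomology spaces with trivial coefficients (classifying one-dimensional central extensions of Lie algebras) of $\mathcal{W}_A(\lambda)$ and $\mathcal{W}_B(\lambda)$ are $$H^2(\mathcal{W}_A(\lambda))=\begin{cases}\mathbb{C}\overline{\Omega}_{\mathrm{Vir}}\oplus\mathbb{C}\overline{\Omega}_0^A\oplus\mathbb{C}\overline{\Omega}_{\mathrm{Mix}}^A,&\text{if }\lambda=0,\\ \mathbb{C}\overline{\Omega}_{\mathrm{Vir}}\oplus\mathbb{C}\overline{\Omega}_{\mathrm{Mix}}^A,&\text{if }\lambda\neq0,\end{cases}$$ $$H^2(\mathcal{W}_B(\lambda))=\mathbb{C}\overline{\Omega}_{\mathrm{Vir}}\oplus\mathbb{C}\overline{\Omega}_{\mathrm{Ab}}^B\oplus\mathbb{C}\overline{\Omega}_{\mathrm{Mix}}^B,$$ where $\overline{\Omega}$ denotes the class of the 2-cocycle $\Omega$, each displayed summand $\mathbb{C}\overline{\Omega}$ is one-dimensional, and the cocycles are as given in the context. Furthermore, $\mathcal{W}_A(\lambda)$ has one extra nontrivial Leibniz central extension (up to multiplication by a scalar), given by the Leibniz 2-cocycle induced by the symmetric invariant bilinear form $\theta_A$ with $$\theta_A(A_n,A_m)=\begin{cases}1,&\text{if }n=m=0,\\0,&\text{otherwise}\end{cases}$$ (and $\theta_A$ zero whenever an argument is some $L_n$), while $\mathcal{W}_B(\lambda)$ has no Leibniz central extensions which are not already extensions of Lie algebras. In other words, $$HL^2(\mathcal{W}_A(\lambda))\cong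 H^2(\mathcal{W}_A(\lambda))\oplus\mathbb{C}\overline{\theta}_A,\qquad HL^2(\mathcal{W}_B(\lambda))\cong H^2(\mathcal{W}_B(\lambda)),$$ where $\overline{\theta}_A$ is the (nonzero) class of $\theta_A$ in $HL^2(\mathcal{W}_A(\lambda))$ and $H^2$ is regarded as a subspace of $HL^2$ via the natural injection.
   Context: All vector spaces are over $\mathbb{C}$. $\delta_n^0$ equals $1$ if $n=0$ and $0$ otherwise. $\mathcal{W}$ is the Witt algebra, with basis $\{L_n\}_{n\in\mathbb{Z}}$ and bracket $[L_n,L_m]=(m-n)L_{n+m}$. For $\lambda\in\mathbb{P}^1=\mathbb{C}\cup\{\infty\}$, $A(\lambda)$ and $B(\lambda)$ are the $\mathcal{W}$-modules with bases $\{A_n\}_{n\in\mathbb{Z}}$, $\{B_n\}_{n\in\mathbb{Z}}$ and actions $$L_n\cdot A_m=(n+m+n(n+1)\lambda\delta_m^0)A_{n+m},\qquad L_n\cdot B_m=(m-n(n+1)\lambda\delta_{n+m}^0)B_{n+m},$$ where for $\lambda=\infty$ the expression $n(n+1)\lambda$ is replaced by $n^2$. For $X\in\{A,B\}$, $\mathcal{W}_X(\lambda)=\mathcal{W}\ltimes X(\lambda)$ is the semi-direct sum in which $X(\lambda)$ is an abelian ideal and $[L_n,X_m]=L_n\cdot X_m$. $H^2(\mathfrak{g})$ is the Lie algebra (Chevalley–Eilenberg) cohomology with coefficients in the trivial module $\mathbb{C}$. Cocycles (antisymmetric bilinear maps; only the components not identically zero are given, and all other components on the basis vanish): on both algebras,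 $$\Omega_{\mathrm{Vir}}(L_n,L_m)=\tfrac1{12}n(n^2-1)\delta_{n+m}^0;$$ on $\mathcal{W}_A(0)$, $\Omega_0^A(L_n,A_m)=n\delta_{n+m}^0$; on $\mathcal{W}_A(\lambda)$, $$\Omega_{\mathrm{Mix}}^A(L_n,A_m)=\begin{cases}(\lambda+1)\delta_m^0,&\text{if }n=0\text{ and }\lambda\ne\infty,\\ \delta_{n+m}^0,&\text{otherwise};\end{cases}$$ on $\mathcal{W}_B(\lambda)$, $\Omega_{\mathrm{Ab}}^B(B_n,B_m)=n\delta_{n+m}^0$ and $$\Omega_{\mathrm{Mix}}^B(L_n,B_m)=\begin{cases}n\delta_{n+m}^0,&\text{if }\lambda\neq0,\\ n(n+1)\delta_{n+m}^0,&\text{if }\lambda=0.\end{cases}$$ For a Lie algebra $\mathfrak{g}$, a Leibniz 2-cocycle is a bilinear map $\alpha:\mathfrak{g}\times\mathfrak{g}\to\mathbb{C}$ (not necessarily antisymmetric) with $\alpha([x,y],z)=\alpha(x,[y,z])+\alpha([x,z],y)$ for all $x,y,z$. $HL^2(\mathfrak{g})$ is the space of Leibniz 2-cocycles modulo the maps $(x,y)\mapsto f([x,y])$ with $f\in\mathfrak{g}^*$; it classifies one-dimensional Leibniz central extensions of $\mathfrak g$. The inclusion of alternating cocycles induces an injection $H^2(\mathfrak{g})\hookrightarrow HL^2(\mathfrak{g})$. A symmetric bilinear form $\theta$ on $\mathfrak{g}$ is invariant if $\theta([x,u],v)+\theta(u,[x,v])=0$ for all $x,u,v\in\mathfrak g$.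 *)

theory Defs
  imports
    Complex_Main
    "HOL-Library.Poly_Mapping"
    "HOL-Library.Product_Plus"
    "HOL-Library.Function_Algebras"
    "HOL-Library.Set_Algebras"
begin

section \<open>Lie algebras, modules and semi-direct sums over the complex numbers\<close>

locale lie_algebra = vector_space scale
  for scale :: "complex \<Rightarrow> 'g::ab_group_add \<Rightarrow> 'g" +
  fixes br :: "'g \<Rightarrow> 'g \<Rightarrow> 'g"
  assumes linear_right: "Vector_Spaces.linear scale scale (br x)"
    and linear_left: "Vector_Spaces.linear scale scale (\<lambda>x. br x y)"
    and alternating: "br x x = 0"
    and jacobi: "br x (br y z) + br y (br z x) + br z (br x y) = 0"

locale lie_module = lie_algebra scale br + M: vector_space mscale
  for scale :: "complex \<Rightarrow> 'g::ab_group_add \<Rightarrow> 'g"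
    and br :: "'g \<Rightarrow> 'g \<Rightarrow> 'g"
    and mscale :: "complex \<Rightarrow> 'm::ab_group_add \<Rightarrow> 'm" +
  fixes act :: "'g \<Rightarrow> 'm \<Rightarrow> 'm"
  assumes act_linear_right: "Vector_Spaces.linear mscale mscale (act x)"
    and act_linear_left: "Vector_Spaces.linear scale mscale (\<lambda>x. act x m)"
    and act_bracket: "act (br x y) m = act x (act y m) - act y (act x m)"

definition prod_scale ::
    "(complex \<Rightarrow> 'g \<Rightarrow> 'g) \<Rightarrow> (complex \<Rightarrow> 'm \<Rightarrow> 'm) \<Rightarrow> complex \<Rightarrow> 'g \<times> 'm \<Rightarrow> 'g \<times> 'm" where
  "prod_scale s t c p = (s c (fst p), t c (snd p))"

definition semidirect ::
    "('g \<Rightarrow> 'g \<Rightarrow> 'g) \<Rightarrow> ('g \<Rightarrow> 'm \<Rightarrow> 'm) \<Rightarrow> 'g \<times> 'm \<Rightarrow> 'g \<times> 'm \<Rightarrow> 'g \<times> 'm::ab_group_add" where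
  "semidirect br act p q = (br (fst p) (fst q), act (fst p) (snd q) - act (fst q) (snd p))"


section \<open>Cohomology in degree two with trivial coefficients\<close>

type_synonym 'g form = "'g \<Rightarrow> 'g \<Rightarrow> complex"

definition bilinear_form :: "(complex \<Rightarrow> 'g \<Rightarrow> 'g::ab_group_add) \<Rightarrow> 'g form \<Rightarrow> bool" where
  "bilinear_form s \<alpha> \<longleftrightarrow>
     (\<forall>x. Vector_Spaces.linear s (*) (\<alpha> x)) \<and> (\<forall>y. Vector_Spaces.linear s (*) (\<lambda>x. \<alpha> x y))"

definition lie_cocycles ::
    "(complex \<Rightarrow> 'g \<Rightarrow> 'g::ab_group_add) \<Rightarrow> ('g \<Rightarrow> 'g \<Rightarrow> 'g) \<Rightarrow> 'g form set" where
  "lie_cocycles s br = {\<alpha>. bilinear_form s \<alpha> \<and> (\<forall>x. \<alpha> x x = 0) \<and>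
     (\<forall>x y z. \<alpha> (br x y) z + \<alpha> (br y z) x + \<alpha> (br z x) y = 0)}"

definition leibniz_cocycles ::
    "(complex \<Rightarrow> 'g \<Rightarrow> 'g::ab_group_add) \<Rightarrow> ('g \<Rightarrow> 'g \<Rightarrow> 'g) \<Rightarrow> 'g form set" where
  "leibniz_cocycles s br = {\<alpha>. bilinear_form s \<alpha> \<and>
     (\<forall>x y z. \<alpha> (br x y) z = \<alpha> x (br y z) + \<alpha> (br x z) y)}"

text \<open>The Lie and the Leibniz theory have the same coboundaries in degree two.\<close>

definition coboundaries ::
    "(complex \<Rightarrow> 'g \<Rightarrow> 'g::ab_group_add) \<Rightarrow> ('g \<Rightarrow> 'g \<Rightarrow> 'g) \<Rightarrow> 'g form set" where
  "coboundaries s br = {\<lambda>x y. f (br x y) | f. Vector_Spaces.linear s (*) f}"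

definition invariant_symmetric_form ::
    "(complex \<Rightarrow> 'g \<Rightarrow> 'g::ab_group_add) \<Rightarrow> ('g \<Rightarrow> 'g \<Rightarrow> 'g) \<Rightarrow> 'g form \<Rightarrow> bool" where
  "invariant_symmetric_form s br \<theta> \<longleftrightarrow> bilinear_form s \<theta> \<and> (\<forall>u v. \<theta> u v = \<theta> v u) \<and>
     (\<forall>x u v. \<theta> (br x u) v + \<theta> u (br x v) = 0)"

definition form_scale :: "complex \<Rightarrow> 'g form \<Rightarrow> 'g form" where
  "form_scale c \<alpha> = (\<lambda>x y. c * \<alpha> x y)"

text \<open>A quotient of a space of forms by a subspace \<open>N\<close> is represented by the set of its
  elements, the cosets \<open>\<alpha> +o N\<close>. Their sum is the elementwise sum of sets, and the zero of the
  quotient is the coset \<open>N\<close>. Elementwise scaling would send every coset to \<open>{0}\<close> for \<open>c = 0\<close>,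
  so \<open>N\<close> is added once more.\<close>

definition coset_scale :: "'g form set \<Rightarrow> complex \<Rightarrow> 'g form set \<Rightarrow> 'g form set" where
  "coset_scale N c S = form_scale c ` S + N"

definition coset_subspace :: "'g form set \<Rightarrow> 'g form set set \<Rightarrow> bool" where
  "coset_subspace N U \<longleftrightarrow> N \<in> U \<and> (\<forall>S\<in>U. \<forall>T\<in>U. S + T \<in> U) \<and> (\<forall>c. \<forall>S\<in>U. coset_scale N c S \<in> U)"

definition coset_line :: "'g form set \<Rightarrow> 'g form set \<Rightarrow> 'g form set set" where
  "coset_line N S = {coset_scale N c S | c. True}"

definition one_dimensional :: "'g form set \<Rightarrow> 'g form set set \<Rightarrow> bool" where
  "one_dimensional N U \<longleftrightarrow> (\<exists>S\<in>U. S \<noteq> N \<and> U = coset_line N S)"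

text \<open>Internal direct sum: the map \<open>(S\<^sub>1, \<dots>, S\<^sub>k) \<mapsto> S\<^sub>1 + \<dots> + S\<^sub>k\<close> from the product
  of the subspaces to \<open>H\<close> is bijective. The list of subspaces has to be nonempty, because
  \<open>sum_list\<close> adds the set \<open>{0}\<close> to the sum, which changes nothing, but returns \<open>{0}\<close> and
  not \<open>N\<close> on the empty list.\<close>

definition internal_direct_sum ::
    "'g form set \<Rightarrow> 'g form set set \<Rightarrow> 'g form set set list \<Rightarrow> bool" where
  "internal_direct_sum N H Us \<longleftrightarrow> Us \<noteq> [] \<and> (\<forall>U\<in>set Us. coset_subspace N U \<and> U \<subseteq> H) \<and>
     bij_betw sum_list (listset Us) H"

definition cohom_class ::
    "(complex \<Rightarrow> 'g \<Rightarrow> 'g::ab_group_add) \<Rightarrow> ('g \<Rightarrow> 'g \<Rightarrow> 'g) \<Rightarrow> 'g form \<Rightarrow> 'g form set" where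
  "cohom_class s br \<alpha> = \<alpha> +o coboundaries s br"

text \<open>Both spaces consist of cosets of the same set \<open>coboundaries s br\<close>; the natural injection
  of \<open>H2\<close> into \<open>HL2\<close> is the inclusion of sets.\<close>

definition H2 ::
    "(complex \<Rightarrow> 'g \<Rightarrow> 'g::ab_group_add) \<Rightarrow> ('g \<Rightarrow> 'g \<Rightarrow> 'g) \<Rightarrow> 'g form set set" where
  "H2 s br = cohom_class s br ` lie_cocycles s br"

definition HL2 ::
    "(complex \<Rightarrow> 'g \<Rightarrow> 'g::ab_group_add) \<Rightarrow> ('g \<Rightarrow> 'g \<Rightarrow> 'g) \<Rightarrow> 'g form set set" where
  "HL2 s br = cohom_class s br ` leibniz_cocycles s br"


text \<open>The line spanned by the class of \<open>\<alpha>\<close>, in \<open>H2\<close> or in \<open>HL2\<close>.\<close>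

definition class_line ::
    "(complex \<Rightarrow> 'g \<Rightarrow> 'g::ab_group_add) \<Rightarrow> ('g \<Rightarrow> 'g \<Rightarrow> 'g) \<Rightarrow> 'g form \<Rightarrow> 'g form set set" where
  "class_line s br \<alpha> = coset_line (coboundaries s br) (cohom_class s br \<alpha>)"


section \<open>The Witt algebra and the modules A and B\<close>

text \<open>A vector space with a basis indexed by the integers: the basis vector of index \<open>n\<close> is
  \<open>Poly_Mapping.single n 1\<close>.\<close>

type_synonym zspace = "int \<Rightarrow>\<^sub>0 complex"

definition zscale :: "complex \<Rightarrow> zspace \<Rightarrow> zspace" where
  "zscale c = Poly_Mapping.map ((*) c)"

definition bilinear_ext ::
    "(complex \<Rightarrow> 'v \<Rightarrow> 'v::comm_monoid_add) \<Rightarrow> (int \<Rightarrow> int \<Rightarrow> 'v) \<Rightarrow> zspace \<Rightarrow> zspace \<Rightarrow> 'v" where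
  "bilinear_ext s b x y = (\<Sum>i\<in>Poly_Mapping.keys x. \<Sum>j\<in>Poly_Mapping.keys y.
     s (Poly_Mapping.lookup x i * Poly_Mapping.lookup y j) (b i j))"

definition witt :: "zspace \<Rightarrow> zspace \<Rightarrow> zspace" where
  "witt = bilinear_ext zscale (\<lambda>n m. Poly_Mapping.single (n + m) (of_int (m - n)))"

text \<open>The projective line.\<close>

datatype P1 = Fin complex | Infty

text \<open>The expression \<open>n(n+1)\<lambda>\<close>, with its convention at infinity.\<close>

fun lam_term :: "P1 \<Rightarrow> int \<Rightarrow> complex" where
  "lam_term (Fin l) n = of_int (n * (n + 1)) * l"
| "lam_term Infty n = of_int (n\<^sup>2)"

definition actA :: "P1 \<Rightarrow> zspace \<Rightarrow> zspace \<Rightarrow> zspace" where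
  "actA lam = bilinear_ext zscale (\<lambda>n m. Poly_Mapping.single (n + m)
     (of_int (n + m) + (if m = 0 then lam_term lam n else 0)))"

definition actB :: "P1 \<Rightarrow> zspace \<Rightarrow> zspace \<Rightarrow> zspace" where
  "actB lam = bilinear_ext zscale (\<lambda>n m. Poly_Mapping.single (n + m)
     (of_int m - (if n + m = 0 then lam_term lam n else 0)))"

text \<open>In the semi-direct sums, \<open>L\<^sub>n\<close> is \<open>(Poly_Mapping.single n 1, 0)\<close>, and \<open>A\<^sub>n\<close>
  or \<open>B\<^sub>n\<close> is \<open>(0, Poly_Mapping.single n 1)\<close>.\<close>

type_synonym wspace = "zspace \<times> zspace"

abbreviation wscale :: "complex \<Rightarrow> wspace \<Rightarrow> wspace" where
  "wscale \<equiv> prod_scale zscale zscale"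

definition W_A :: "P1 \<Rightarrow> wspace \<Rightarrow> wspace \<Rightarrow> wspace" where
  "W_A lam = semidirect witt (actA lam)"

definition W_B :: "P1 \<Rightarrow> wspace \<Rightarrow> wspace \<Rightarrow> wspace" where
  "W_B lam = semidirect witt (actB lam)"


abbreviation (input) "bd_A lam \<equiv> coboundaries wscale (W_A lam)"
abbreviation (input) "bd_B lam \<equiv> coboundaries wscale (W_B lam)"
abbreviation (input) "line_A lam \<equiv> class_line wscale (W_A lam)"
abbreviation (input) "line_B lam \<equiv> class_line wscale (W_B lam)"


section \<open>The cocycles\<close>

text \<open>The form with components \<open>ll\<close> on \<open>(L\<^sub>n, L\<^sub>m)\<close>, \<open>lx\<close> on \<open>(L\<^sub>n, X\<^sub>m)\<close> and
  \<open>xx\<close> on \<open>(X\<^sub>n, X\<^sub>m)\<close>, whose component on \<open>(X\<^sub>m, L\<^sub>n)\<close> is the negative of \<open>lx\<close>. It is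
  antisymmetric if \<open>ll\<close> and \<open>xx\<close> are.\<close>

definition antisym_form ::
    "(int \<Rightarrow> int \<Rightarrow> complex) \<Rightarrow> (int \<Rightarrow> int \<Rightarrow> complex) \<Rightarrow> (int \<Rightarrow> int \<Rightarrow> complex) \<Rightarrow> wspace form" where
  "antisym_form ll lx xx p q =
     bilinear_ext (*) ll (fst p) (fst q)
     + bilinear_ext (*) lx (fst p) (snd q) - bilinear_ext (*) lx (fst q) (snd p)
     + bilinear_ext (*) xx (snd p) (snd q)"

definition Omega_Vir :: "wspace form" where
  "Omega_Vir = antisym_form
     (\<lambda>n m. if n + m = 0 then of_int (n * (n\<^sup>2 - 1)) / 12 else 0) (\<lambda>_ _. 0) (\<lambda>_ _. 0)"

definition Omega_A0 :: "wspace form" where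
  "Omega_A0 = antisym_form (\<lambda>_ _. 0) (\<lambda>n m. if n + m = 0 then of_int n else 0) (\<lambda>_ _. 0)"

definition Omega_A_Mix :: "P1 \<Rightarrow> wspace form" where
  "Omega_A_Mix lam = antisym_form (\<lambda>_ _. 0)
     (\<lambda>n m. case lam of
         Fin l \<Rightarrow> if n = 0 then (if m = 0 then l + 1 else 0) else (if n + m = 0 then 1 else 0)
       | Infty \<Rightarrow> if n + m = 0 then 1 else 0)
     (\<lambda>_ _. 0)"

definition Omega_B_Ab :: "wspace form" where
  "Omega_B_Ab = antisym_form (\<lambda>_ _. 0) (\<lambda>_ _. 0) (\<lambda>n m. if n + m = 0 then of_int n else 0)"

definition Omega_B_Mix :: "P1 \<Rightarrow> wspace form" where
  "Omega_B_Mix lam = antisym_form (\<lambda>_ _. 0)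
     (\<lambda>n m. if lam \<noteq> Fin 0 then (if n + m = 0 then of_int n else 0)
            else (if n + m = 0 then of_int (n * (n + 1)) else 0))
     (\<lambda>_ _. 0)"

definition theta_A :: "wspace form" where
  "theta_A p q = bilinear_ext (*) (\<lambda>n m. if n = 0 \<and> m = 0 then 1 else 0) (snd p) (snd q)"


section \<open>The semi-direct sums are Lie algebras\<close>

lemma lookup_zscale [simp]: "Poly_Mapping.lookup (zscale c x) i = c * Poly_Mapping.lookup x i"
  unfolding zscale_def by (simp add: Poly_Mapping.map.rep_eq when_def)

lemma zscale_single [simp]: "zscale c (Poly_Mapping.single n a) = Poly_Mapping.single n (c * a)"
  by (rule poly_mapping_eqI) (simp add: lookup_single when_def)

lemma vector_space_zscale: "vector_space zscale"
  by unfold_locales (auto intro!: poly_mapping_eqI simp: lookup_add algebra_simps)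

lemma vector_space_times: "vector_space ((*) :: complex \<Rightarrow> complex \<Rightarrow> complex)"
  by unfold_locales (auto simp: algebra_simps)

lemma vector_space_prod_scale:
  assumes "vector_space s" and "vector_space t"
  shows "vector_space (prod_scale s t)"
proof -
  interpret s: vector_space s by fact
  interpret t: vector_space t by fact
  show ?thesis
    by unfold_locales
      (auto simp: prod_scale_def s.scale_right_distrib s.scale_left_distrib
        t.scale_right_distrib t.scale_left_distrib)
qed

lemma linearI':
  assumes "vector_space s" "vector_space t"
    and "\<And>x y. f (x + y) = f x + f y" and "\<And>c x. f (s c x) = t c (f x)"
  shows "Vector_Spaces.linear s t f"
  using assms by (simp add: Vector_Spaces.linear_iff)

lemma zspace_expand:
  assumes K: "finite K" "Poly_Mapping.keys x \<subseteq> K"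
  shows "x = (\<Sum>i\<in>K. zscale (Poly_Mapping.lookup x i) (Poly_Mapping.single i 1))"
proof (rule poly_mapping_eqI)
  fix k
  have "(\<Sum>i\<in>K. Poly_Mapping.lookup x i when i = k) = Poly_Mapping.lookup x k"
  proof (cases "k \<in> K")
    case True
    then show ?thesis using K by (simp add: when_def)
  next
    case False
    then show ?thesis using K by (auto simp: when_def in_keys_iff intro!: sum.neutral)
  qed
  then show "Poly_Mapping.lookup x k =
      Poly_Mapping.lookup (\<Sum>i\<in>K. zscale (Poly_Mapping.lookup x i) (Poly_Mapping.single i 1)) k"
    by (simp add: lookup_sum lookup_single)
qed

lemma zspace_linear_eqI:
  assumes f: "Vector_Spaces.linear zscale s f" and g: "Vector_Spaces.linear zscale s g"
    and eq: "\<And>n. f (Poly_Mapping.single n 1) = g (Poly_Mapping.single n 1)"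
  shows "f x = g x"
proof -
  interpret f: Vector_Spaces.linear zscale s f by fact
  interpret g: Vector_Spaces.linear zscale s g by fact
  have x: "x = (\<Sum>i\<in>Poly_Mapping.keys x.
      zscale (Poly_Mapping.lookup x i) (Poly_Mapping.single i 1))"
    by (rule zspace_expand) auto
  show ?thesis
    by (subst (1 2) x) (simp only: f.sum g.sum f.scale g.scale eq)
qed

lemma bilinear_ext_superset:
  assumes s: "vector_space s" and "finite K" "Poly_Mapping.keys x \<subseteq> K"
    and "finite J" "Poly_Mapping.keys y \<subseteq> J"
  shows "bilinear_ext s b x y =
    (\<Sum>i\<in>K. \<Sum>j\<in>J. s (Poly_Mapping.lookup x i * Poly_Mapping.lookup y j) (b i j))"
proof -
  interpret vector_space s by fact
  have "bilinear_ext s b x y = (\<Sum>i\<in>Poly_Mapping.keys x. \<Sum>j\<in>J.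
      s (Poly_Mapping.lookup x i * Poly_Mapping.lookup y j) (b i j))"
    unfolding bilinear_ext_def using assms
    by (intro sum.cong sum.mono_neutral_left) (auto simp: in_keys_iff)
  also have "\<dots> = (\<Sum>i\<in>K. \<Sum>j\<in>J. s (Poly_Mapping.lookup x i * Poly_Mapping.lookup y j) (b i j))"
    using assms by (intro sum.mono_neutral_left) (auto simp: in_keys_iff)
  finally show ?thesis .
qed

lemma bilinear_ext_single [simp]:
  assumes "vector_space s"
  shows "bilinear_ext s b (Poly_Mapping.single n a) (Poly_Mapping.single m c) = s (a * c) (b n m)"
  by (subst bilinear_ext_superset[OF assms, of "{n}" _ "{m}"]) auto

lemma linear_bilinear_ext_right:
  assumes s: "vector_space s"
  shows "Vector_Spaces.linear zscale s (bilinear_ext s b x)"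
proof (rule linearI'[OF vector_space_zscale s])
  interpret vector_space s by fact
  fix y z :: zspace and c :: complex
  let ?K = "Poly_Mapping.keys x"
  let ?J = "Poly_Mapping.keys y \<union> Poly_Mapping.keys z"
  have e: "bilinear_ext s b x w =
      (\<Sum>i\<in>?K. \<Sum>j\<in>?J. s (Poly_Mapping.lookup x i * Poly_Mapping.lookup w j) (b i j))"
    if "Poly_Mapping.keys w \<subseteq> ?J" for w
    using that by (intro bilinear_ext_superset[OF s]) auto
  show "bilinear_ext s b x (y + z) = bilinear_ext s b x y + bilinear_ext s b x z"
    using Poly_Mapping.keys_add[of y z]
    by (simp add: e lookup_add distrib_left scale_left_distrib sum.distrib)
  have "Poly_Mapping.keys (zscale c y) \<subseteq> ?J" by (auto simp: in_keys_iff)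
  then show "bilinear_ext s b x (zscale c y) = s c (bilinear_ext s b x y)"
    by (simp add: e scale_sum_right mult.left_commute)
qed

lemma bilinear_ext_flip: "bilinear_ext s b x y = bilinear_ext s (\<lambda>i j. b j i) y x"
  unfolding bilinear_ext_def by (subst sum.swap) (simp add: mult.commute)

lemma linear_bilinear_ext_left:
  assumes "vector_space s"
  shows "Vector_Spaces.linear zscale s (\<lambda>x. bilinear_ext s b x y)"
  by (subst bilinear_ext_flip) (rule linear_bilinear_ext_right[OF assms])

lemma witt_single:
  "witt (Poly_Mapping.single n 1) (Poly_Mapping.single m 1) =
     Poly_Mapping.single (n + m) (of_int (m - n))"
  by (simp add: witt_def vector_space_zscale)

lemma witt_single_any:
  "witt (Poly_Mapping.single n a) (Poly_Mapping.single m c) =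
     Poly_Mapping.single (n + m) (a * c * of_int (m - n))"
  by (simp add: witt_def vector_space_zscale)

lemma actA_single:
  "actA lam (Poly_Mapping.single n 1) (Poly_Mapping.single m 1) =
     Poly_Mapping.single (n + m) (of_int (n + m) + (if m = 0 then lam_term lam n else 0))"
  by (simp add: actA_def vector_space_zscale)

lemma actB_single:
  "actB lam (Poly_Mapping.single n 1) (Poly_Mapping.single m 1) =
     Poly_Mapping.single (n + m) (of_int m - (if n + m = 0 then lam_term lam n else 0))"
  by (simp add: actB_def vector_space_zscale)

lemma lie_module_semidirect:
  assumes "lie_module s br t act"
  shows "lie_algebra (prod_scale s t) (semidirect br act)"
proof -
  interpret lie_module s br t act by fact
  interpret P: vector_space "prod_scale s t"
    by (rule vector_space_prod_scale) unfold_locales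
  have add: "br x (y + z) = br x y + br x z" "br (x + y) z = br x z + br y z"
    "act x (m + m') = act x m + act x m'" "act (x + y) m = act x m + act y m" for x y z m m'
    using linear_right linear_left act_linear_right act_linear_left
    unfolding Vector_Spaces.linear_iff by auto
  have sc: "br x (s c y) = s c (br x y)" "br (s c x) y = s c (br x y)"
    "act x (t c m) = t c (act x m)" "act (s c x) m = t c (act x m)" for c x y m
    using linear_right linear_left act_linear_right act_linear_left
    unfolding Vector_Spaces.linear_iff by auto
  have diff: "act x (m - m') = act x m - act x m'" for x m m'
    using add(3)[of x "m - m'" m'] by (simp add: algebra_simps)
  show ?thesis
  proof (intro lie_algebra.intro lie_algebra_axioms.intro P.vector_space_axioms)
    fix x y z
    show "Vector_Spaces.linear (prod_scale s t) (prod_scale s t) (semidirect br act x)"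
      by (rule linearI') (unfold_locales,
        auto simp: semidirect_def prod_scale_def add sc M.scale_right_diff_distrib)
    show "Vector_Spaces.linear (prod_scale s t) (prod_scale s t) (\<lambda>x. semidirect br act x y)"
      by (rule linearI') (unfold_locales,
        auto simp: semidirect_def prod_scale_def add sc M.scale_right_diff_distrib)
    show "semidirect br act x x = 0"
      by (simp add: semidirect_def alternating zero_prod_def)
    show "semidirect br act x (semidirect br act y z) + semidirect br act y (semidirect br act z x)
        + semidirect br act z (semidirect br act x y) = 0"
      by (simp add: semidirect_def jacobi zero_prod_def diff act_bracket)
  qed
qed

text \<open>Two trilinear maps on \<open>zspace\<close> that agree on the basis are equal.\<close>

lemma zspace_trilinear_eqI:
  assumes "\<And>y z. Vector_Spaces.linear zscale s (\<lambda>x. f x y z)"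
    "\<And>y z. Vector_Spaces.linear zscale s (\<lambda>x. g x y z)"
    and "\<And>x z. Vector_Spaces.linear zscale s (\<lambda>y. f x y z)"
    "\<And>x z. Vector_Spaces.linear zscale s (\<lambda>y. g x y z)"
    and "\<And>x y. Vector_Spaces.linear zscale s (f x y)"
    "\<And>x y. Vector_Spaces.linear zscale s (g x y)"
    and "\<And>n m k. f (Poly_Mapping.single n 1) (Poly_Mapping.single m 1) (Poly_Mapping.single k 1) =
      g (Poly_Mapping.single n 1) (Poly_Mapping.single m 1) (Poly_Mapping.single k 1)"
  shows "f x y z = g x y z"
proof -
  let ?e = "\<lambda>n. Poly_Mapping.single n 1 :: zspace"
  have "f (?e n) (?e m) z = g (?e n) (?e m) z" for n m
    using zspace_linear_eqI[OF assms(5)[of "?e n" "?e m"] assms(6)[of "?e n" "?e m"] assms(7)] by blast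
  then have "f (?e n) y z = g (?e n) y z" for n
    using zspace_linear_eqI[OF assms(3)[of "?e n" z] assms(4)[of "?e n" z]] by blast
  then show ?thesis
    using zspace_linear_eqI[OF assms(1)[of y z] assms(2)[of y z]] by blast
qed

lemma witt_linear:
  "Vector_Spaces.linear zscale zscale (witt x)"
  "Vector_Spaces.linear zscale zscale (\<lambda>x. witt x y)"
  unfolding witt_def
  by (intro linear_bilinear_ext_right linear_bilinear_ext_left vector_space_zscale)+

lemma witt_bilinear:
  "witt x (y + z) = witt x y + witt x z" "witt (x + y) z = witt x z + witt y z"
  "witt x (zscale c y) = zscale c (witt x y)" "witt (zscale c x) y = zscale c (witt x y)"
  using witt_linear unfolding Vector_Spaces.linear_iff by auto

lemma lie_algebra_witt: "lie_algebra zscale witt"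
proof -
  interpret vector_space zscale by (rule vector_space_zscale)
  note lin = linearI'[OF vector_space_zscale vector_space_zscale]
  have diag: "witt x x = 0" for x
  proof -
    have flip: "witt y z = zscale (-1) (witt z y)" for y z
    proof -
      have 1: "witt (Poly_Mapping.single n 1) z = zscale (-1) (witt z (Poly_Mapping.single n 1))" for n
        by (rule zspace_linear_eqI[where s = zscale and x = z])
          (auto intro!: lin poly_mapping_eqI
            simp: witt_bilinear scale_right_distrib witt_single lookup_add lookup_single when_def
              algebra_simps)
      show ?thesis
        by (rule zspace_linear_eqI[where s = zscale and x = y])
          (auto intro!: lin simp: witt_bilinear scale_right_distrib mult.commute 1
            simp del: scale_minus_left)
    qed
    have "witt x x + witt x x = 0"
      using flip[of x x] by (simp add: add_eq_0_iff)
    then have "zscale 2 (witt x x) = 0"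
      by (metis scale_left_distrib scale_one one_add_one)
    then show ?thesis by simp
  qed
  have jac: "witt x (witt y z) + witt y (witt z x) + witt z (witt x y) = 0" for x y z
    by (rule zspace_trilinear_eqI[where s = zscale and g = "\<lambda>_ _ _. 0" and x = x and y = y and z = z
          and f = "\<lambda>x y z. witt x (witt y z) + witt y (witt z x) + witt z (witt x y)"])
      (auto intro!: lin poly_mapping_eqI
        simp: witt_bilinear scale_right_distrib witt_single_any lookup_add lookup_single when_def
          algebra_simps)
  show ?thesis
    by (intro lie_algebra.intro lie_algebra_axioms.intro vector_space_zscale witt_linear diag jac)
qed

lemma lie_module_zspace:
  fixes c :: "int \<Rightarrow> int \<Rightarrow> complex"
  defines "act \<equiv> bilinear_ext zscale (\<lambda>n m. Poly_Mapping.single (n + m) (c n m))"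
  assumes basis: "\<And>n m k. of_int (m - n) * c (n + m) k = c m k * c n (m + k) - c n k * c m (n + k)"
  shows "lie_module zscale witt zscale act"
proof -
  interpret lie_algebra zscale witt by (rule lie_algebra_witt)
  note lin = linearI'[OF vector_space_zscale vector_space_zscale]
  have act_lin: "Vector_Spaces.linear zscale zscale (act x)"
    "Vector_Spaces.linear zscale zscale (\<lambda>x. act x y)" for x y
    unfolding act_def
    by (intro linear_bilinear_ext_right linear_bilinear_ext_left vector_space_zscale)+
  have act_bilin: "act x (y + z) = act x y + act x z" "act (x + y) z = act x z + act y z"
    "act x (zscale c y) = zscale c (act x y)" "act (zscale c x) y = zscale c (act x y)" for x y z c
    using act_lin unfolding Vector_Spaces.linear_iff by auto
  have act_single: "act (Poly_Mapping.single n a) (Poly_Mapping.single m d) =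
      Poly_Mapping.single (n + m) (a * d * c n m)"
    for n m a d by (simp add: act_def vector_space_zscale)
  have base: "act (witt (Poly_Mapping.single n 1) (Poly_Mapping.single m 1)) (Poly_Mapping.single k 1) =
      act (Poly_Mapping.single n 1) (act (Poly_Mapping.single m 1) (Poly_Mapping.single k 1))
      - act (Poly_Mapping.single m 1) (act (Poly_Mapping.single n 1) (Poly_Mapping.single k 1))"
    for n m k
  proof -
    have "m + (n + k) = n + (m + k)" "n + m + k = n + (m + k)" by auto
    then show ?thesis
      using basis[of m n k] by (simp only: witt_single act_single mult_1 mult_1_right flip: single_diff)
  qed
  have "act (witt x y) m = act x (act y m) - act y (act x m)" for x y m
    by (rule zspace_trilinear_eqI[where s = zscale and x = x and y = y and z = m
          and f = "\<lambda>x y m. act (witt x y) m" and g = "\<lambda>x y m. act x (act y m) - act y (act x m)"])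
      (auto intro!: lin simp: witt_bilinear act_bilin scale_right_distrib scale_right_diff_distrib base)
  then show ?thesis
    by (intro lie_module.intro lie_module_axioms.intro lie_algebra_witt vector_space_zscale act_lin)
qed

lemma lam_term_0 [simp]: "lam_term lam 0 = 0"
  by (cases lam) simp_all

theorem lie_algebra_W_A: "lie_algebra wscale (W_A lam)"
  unfolding W_A_def actA_def
proof (intro lie_module_semidirect lie_module_zspace)
  fix n m k :: int
  let ?c = "\<lambda>n m. of_int (n + m) + (if m = 0 then lam_term lam n else 0)"
  consider "k = 0" | "k \<noteq> 0" "k = - m" "k \<noteq> - n" | "k \<noteq> 0" "k = - n" "k \<noteq> - m" | "k \<noteq> 0" "k = - n" "k = - m"
    | "k \<noteq> 0" "m + k \<noteq> 0" "n + k \<noteq> 0" by linarith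
  then show "of_int (m - n) * ?c (n + m) k = ?c m k * ?c n (m + k) - ?c n k * ?c m (n + k)"
    by cases (cases lam; simp add: algebra_simps power2_eq_square; fail)+
qed

theorem lie_algebra_W_B: "lie_algebra wscale (W_B lam)"
  unfolding W_B_def actB_def
proof (intro lie_module_semidirect lie_module_zspace)
  fix m n k :: int
  let ?c = "\<lambda>n m. of_int m - (if n + m = 0 then lam_term lam n else 0)"
  have eqs: "n + (m + k) = n + m + k" "m + (n + k) = n + m + k" by auto
  show "of_int (m - n) * ?c (n + m) k = ?c m k * ?c n (m + k) - ?c n k * ?c m (n + k)"
  proof (cases "n + m + k = 0")
    case True
    then have k: "k = - n - m" by simp
    show ?thesis
      by (cases "n = 0"; cases "m = 0"; cases lam; simp add: k algebra_simps power2_eq_square)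
  next
    case False
    have "of_int m = (- of_int k :: complex)" if "m + k = 0"
      using that by (metis add.commute eq_neg_iff_add_eq_0 of_int_minus)
    moreover have "of_int n = (- of_int k :: complex)" if "n + k = 0"
      using that by (metis add.commute eq_neg_iff_add_eq_0 of_int_minus)
    ultimately show ?thesis
      using False by (cases "m + k = 0"; cases "n + k = 0") (simp_all add: eqs, simp_all add: algebra_simps)
  qed
qed

lemma coset_add: "\<alpha> +o coboundaries s br + (\<beta> +o coboundaries s br) =
    (\<alpha> + \<beta>) +o coboundaries s br"
  if "vector_space s"
proof -
  interpret s: vector_space s by fact
  have lin: "Vector_Spaces.linear s (*) (\<lambda>x. f x + g x)"
    if "Vector_Spaces.linear s (*) f" "Vector_Spaces.linear s (*) g" for f g :: "'a \<Rightarrow> complex"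
    using that by (simp add: Vector_Spaces.linear_iff algebra_simps)
  have zero: "Vector_Spaces.linear s (*) (\<lambda>_. 0 :: complex)"
    by (simp add: Vector_Spaces.linear_iff s.vector_space_axioms vector_space_times)
  have "coboundaries s br + coboundaries s br = coboundaries s br"
  proof
    show "coboundaries s br + coboundaries s br \<subseteq> coboundaries s br"
      by (force simp: coboundaries_def set_plus_def plus_fun_def intro: lin)
    have "0 \<in> coboundaries s br"
      using zero by (force simp: coboundaries_def zero_fun_def)
    then show "coboundaries s br \<subseteq> coboundaries s br + coboundaries s br"
      by (rule set_zero_plus2)
  qed
  then show ?thesis by (metis set_plus_rearrange)
qed

lemma coset_scale_class: "coset_scale (coboundaries s br) c (cohom_class s br \<alpha>) =
    cohom_class s br (form_scale c \<alpha>)"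
  if "vector_space s"
proof -
  interpret s: vector_space s by fact
  have lin: "Vector_Spaces.linear s (*) (\<lambda>x. c * f x + g x)"
    if "Vector_Spaces.linear s (*) f" "Vector_Spaces.linear s (*) g" for f g :: "'a \<Rightarrow> complex"
    using that by (simp add: Vector_Spaces.linear_iff algebra_simps)
  have zero: "Vector_Spaces.linear s (*) (\<lambda>_. 0 :: complex)"
    by (simp add: Vector_Spaces.linear_iff s.vector_space_axioms vector_space_times)
  show ?thesis
  proof
    show "coset_scale (coboundaries s br) c (cohom_class s br \<alpha>) \<subseteq> cohom_class s br (form_scale c \<alpha>)"
    proof
      fix \<gamma> assume "\<gamma> \<in> coset_scale (coboundaries s br) c (cohom_class s br \<alpha>)"
      then obtain f g where f: "Vector_Spaces.linear s (*) f" and g: "Vector_Spaces.linear s (*) g"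
        and \<gamma>: "\<gamma> = form_scale c (\<alpha> + (\<lambda>x y. f (br x y))) + (\<lambda>x y. g (br x y))"
        by (auto simp: coset_scale_def cohom_class_def coboundaries_def set_plus_def elt_set_plus_def)
      have "\<gamma> = form_scale c \<alpha> + (\<lambda>x y. c * f (br x y) + g (br x y))"
        unfolding \<gamma> by (simp add: fun_eq_iff form_scale_def algebra_simps)
      with lin[OF f g] show "\<gamma> \<in> cohom_class s br (form_scale c \<alpha>)"
        unfolding cohom_class_def elt_set_plus_def coboundaries_def by auto
    qed
    show "cohom_class s br (form_scale c \<alpha>) \<subseteq> coset_scale (coboundaries s br) c (cohom_class s br \<alpha>)"
    proof -
      have "0 \<in> coboundaries s br"
        using zero by (force simp: coboundaries_def zero_fun_def)
      then have "\<alpha> \<in> cohom_class s br \<alpha>"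
        by (force simp: cohom_class_def elt_set_plus_def)
      then show ?thesis
        by (auto simp: coset_scale_def cohom_class_def[of s br "form_scale c \<alpha>"] set_plus_def
            elt_set_plus_def)
    qed
  qed
qed

lemma H2_subset_HL2:
  assumes "lie_algebra s br"
  shows "H2 s br \<subseteq> HL2 s br"
proof -
  interpret lie_algebra s br by fact
  have "lie_cocycles s br \<subseteq> leibniz_cocycles s br"
  proof
    fix \<alpha> assume a: "\<alpha> \<in> lie_cocycles s br"
    then have add: "\<alpha> (u + v) w = \<alpha> u w + \<alpha> v w" "\<alpha> w (u + v) = \<alpha> w u + \<alpha> w v" for u v w
      by (auto simp: lie_cocycles_def bilinear_form_def Vector_Spaces.linear_iff)
    have br_add: "br (u + v) w = br u w + br v w" "br w (u + v) = br w u + br w v" for u v w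
      using linear_left linear_right by (auto simp: Vector_Spaces.linear_iff)
    have alt: "\<alpha> u u = 0" for u using a by (simp add: lie_cocycles_def)
    have anti: "\<alpha> u v = - \<alpha> v u" for u v
      using alt[of "u + v"] unfolding add by (simp add: alt eq_neg_iff_add_eq_0 add.commute)
    have br_anti: "br u v = - br v u" for u v
      using alternating[of "u + v"] unfolding br_add
      by (simp add: alternating eq_neg_iff_add_eq_0 add.commute)
    have neg: "\<alpha> (- u) v = - \<alpha> u v" for u v
      using add(1)[of u "- u" v] add(1)[of 0 0 v] by (simp add: add_eq_0_iff)
    have "\<alpha> (br x y) z = \<alpha> x (br y z) + \<alpha> (br x z) y" for x y z
    proof -
      have "\<alpha> (br x y) z + \<alpha> (br y z) x + \<alpha> (br z x) y = 0"
        using a by (simp add: lie_cocycles_def)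
      moreover have "\<alpha> (br z x) y = - \<alpha> (br x z) y"
        by (metis br_anti neg)
      ultimately show ?thesis using anti[of x "br y z"] by (simp add: algebra_simps)
    qed
    then show "\<alpha> \<in> leibniz_cocycles s br"
      using a unfolding lie_cocycles_def leibniz_cocycles_def by blast
  qed
  then show ?thesis unfolding H2_def HL2_def by (rule image_mono)
qed

end

theory Submission
  imports Defs
begin

text \<open>
  The statement is proved by an explicit description of all Leibniz 2-cocycles of both algebras.

  A Leibniz 2-cocycle is split into a symmetric and an alternating part. Its symmetrization is an
  invariant symmetric form, and a Leibniz cocycle that is alternating is the same thing as a Lie
  cocycle. Invariance under \<open>L\<^sub>0\<close>, which acts on \<open>L\<^sub>n\<close> and \<open>X\<^sub>n\<close> with
  eigenvalue \<open>n\<close>, forces an invariant form to pair degree \<open>n\<close> with degree \<open>-n\<close> only, and the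
  invariance under the other \<open>L\<^sub>n\<close> then becomes a recursion for the values on these pairs.
  The recursions have no nonzero solutions on the components \<open>LL\<close> and \<open>LX\<close>
  (\<open>invariant_form_LL_LX\<close>). On \<open>XX\<close> they leave the square of the functional \<open>A\<^sub>0\<^sup>*\<close> on A
  (a residue pairing: the functional \<open>A\<^sub>0\<^sup>*\<close> kills all brackets), and on B only the antisymmetric
  solution \<open>n \<delta>\<close>. Hence \<open>\<theta>\<^sub>A\<close> is the only source of Leibniz cocycles that are not alternating.

  For Lie cocycles the same grading argument works after a change by a coboundary: dividing by
  the eigenvalue of \<open>L\<^sub>0\<close> removes the components of nonzero total degree
  (\<open>lie_cocycle_normal_form\<close>). What remains are three functions of one integer, the values on
  \<open>(L\<^sub>n, L\<^sub>-\<^sub>n)\<close>, \<open>(L\<^sub>n, X\<^sub>-\<^sub>n)\<close> and \<open>(X\<^sub>n, X\<^sub>-\<^sub>n)\<close>, each satisfying its own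
  recursion. The first is the classical one with solution \<open>n(n\<^sup>2 - 1)\<close>; the third is again
  invariance. The second is where \<open>\<lambda>\<close> enters. On A its solutions are \<open>a + b n\<close> for \<open>n \<noteq> 0\<close>;
  the equations of total degree zero fix the value at \<open>0\<close> and exclude \<open>b \<noteq> 0\<close> unless
  \<open>\<lambda> = 0\<close>, and no coboundary is left. On B the solutions are \<open>a n + b n\<^sup>2\<close>, and the dual of
  \<open>B\<^sub>0\<close> still gives a coboundary, a multiple of \<open>n + n(n + 1)\<lambda>\<close>
  (of \<open>n + n\<^sup>2\<close> at infinity), which is not proportional to \<open>n\<close>
  if \<open>\<lambda> \<noteq> 0\<close> and equal to it if \<open>\<lambda> = 0\<close>. This explains the two forms of
  \<open>\<Omega>\<^sub>M\<^sub>i\<^sub>x\<close> on B.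

  Independence of the classes is read off on the pairs of degrees \<open>1, -1\<close> and
  \<open>2, -2\<close>, and for \<open>\<theta>\<^sub>A\<close> on \<open>(A\<^sub>0, A\<^sub>0)\<close>.
\<close>

section \<open>Cosets of a subspace of forms\<close>

interpretation forms: vector_space "form_scale :: complex \<Rightarrow> 'g form \<Rightarrow> 'g form"
  by unfold_locales (auto simp: form_scale_def fun_eq_iff algebra_simps)

lemma listset_map_image: "listset (map ((`) f) Vs) = map f ` listset Vs"
proof (induction Vs)
  case Nil
  show ?case by simp
next
  case (Cons V Vs)
  have "set_Cons (f ` V) (map f ` W) = map f ` set_Cons V W" for W
    unfolding set_Cons_def by (auto intro!: image_eqI[where f = "map f"])
  with Cons show ?case by simp
qed

lemma in_listset_iff: "vs \<in> listset Vs \<longleftrightarrow> list_all2 (\<in>) vs Vs"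
proof (induction Vs arbitrary: vs)
  case Nil
  show ?case by simp
next
  case (Cons V Vs)
  then show ?case by (cases vs) (auto simp: set_Cons_def)
qed

lemma sum_list_in_subspace: "forms.subspace Z \<Longrightarrow> set vs \<subseteq> Z \<Longrightarrow> sum_list vs \<in> Z"
  by (induction vs) (auto simp: forms.subspace_0 forms.subspace_add)

lemma coboundaries_subspace:
  assumes "vector_space s"
  shows "forms.subspace (coboundaries s br)"
proof (rule forms.subspaceI)
  interpret s: vector_space s by fact
  have zero: "Vector_Spaces.linear s (*) (\<lambda>_. 0 :: complex)"
    by (simp add: Vector_Spaces.linear_iff s.vector_space_axioms vector_space_times)
  then show "0 \<in> coboundaries s br"
    by (force simp: coboundaries_def zero_fun_def)
  fix \<alpha> assume "\<alpha> \<in> coboundaries s br"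
  then obtain f where f: "Vector_Spaces.linear s (*) f" "\<alpha> = (\<lambda>x y. f (br x y))"
    by (auto simp: coboundaries_def)
  {
    fix c
    have "Vector_Spaces.linear s (*) (\<lambda>x. c * f x)"
      using f by (simp add: Vector_Spaces.linear_iff algebra_simps)
    then show "form_scale c \<alpha> \<in> coboundaries s br"
      unfolding coboundaries_def by (intro CollectI exI[of _ "\<lambda>x. c * f x"]) (simp add: form_scale_def f)
  }
  fix \<beta> assume "\<beta> \<in> coboundaries s br"
  then obtain g where g: "Vector_Spaces.linear s (*) g" "\<beta> = (\<lambda>x y. g (br x y))"
    by (auto simp: coboundaries_def)
  have "Vector_Spaces.linear s (*) (\<lambda>x. f x + g x)"
    using f g by (simp add: Vector_Spaces.linear_iff algebra_simps)
  moreover have "\<alpha> + \<beta> = (\<lambda>x y. f (br x y) + g (br x y))"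
    by (simp add: f g fun_eq_iff)
  ultimately show "\<alpha> + \<beta> \<in> coboundaries s br"
    unfolding coboundaries_def by (intro CollectI exI[of _ "\<lambda>x. f x + g x"]) simp
qed

context
  fixes s :: "complex \<Rightarrow> 'g::ab_group_add \<Rightarrow> 'g" and br :: "'g \<Rightarrow> 'g \<Rightarrow> 'g"
  assumes vs: "vector_space s"
begin

private abbreviation (input) "N \<equiv> coboundaries s br"
private abbreviation (input) "cls \<equiv> cohom_class s br"

private lemmas N_subspace = coboundaries_subspace[OF vs, of br]

lemma cohom_class_0: "cls 0 = N"
  by (simp add: cohom_class_def)

lemma cohom_class_add: "cls \<alpha> + cls \<beta> = cls (\<alpha> + \<beta>)"
  unfolding cohom_class_def by (rule coset_add[OF vs])

lemma cohom_class_eq_iff: "cls \<alpha> = cls \<beta> \<longleftrightarrow> \<alpha> - \<beta> \<in> N"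
proof
  assume eq: "cls \<alpha> = cls \<beta>"
  have "\<alpha> \<in> cls \<alpha>"
    unfolding cohom_class_def elt_set_plus_def
    using forms.subspace_0[OF N_subspace] by force
  then show "\<alpha> - \<beta> \<in> N"
    unfolding eq by (auto simp: cohom_class_def elt_set_plus_def)
next
  assume d: "\<alpha> - \<beta> \<in> N"
  then have "\<alpha> - \<beta> + \<gamma> \<in> N" "\<gamma> - (\<alpha> - \<beta>) \<in> N" if "\<gamma> \<in> N" for \<gamma>
    using that N_subspace by (auto intro: forms.subspace_add forms.subspace_diff)
  moreover have "\<alpha> + \<gamma> = \<beta> + (\<alpha> - \<beta> + \<gamma>)" "\<beta> + \<gamma> = \<alpha> + (\<gamma> - (\<alpha> - \<beta>))" for \<gamma>
    by simp_all
  ultimately show "cls \<alpha> = cls \<beta>"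
    unfolding cohom_class_def elt_set_plus_def by blast
qed

lemma sum_list_cohom_class:
  assumes "\<alpha>s \<noteq> []"
  shows "sum_list (map cls \<alpha>s) = cls (sum_list \<alpha>s)"
  using assms
proof (induction \<alpha>s rule: list_nonempty_induct)
  case (single \<alpha>)
  show ?case by simp
next
  case (cons \<alpha> \<alpha>s)
  then show ?case by (simp only: list.map sum_list.Cons cohom_class_add)
qed

lemma coset_subspace_image:
  assumes "forms.subspace V"
  shows "coset_subspace N (cls ` V)"
  unfolding coset_subspace_def
proof (intro conjI ballI allI)
  show "N \<in> cls ` V"
    using forms.subspace_0[OF assms] cohom_class_0 by force
  fix S c assume S: "S \<in> cls ` V"
  then show "coset_scale N c S \<in> cls ` V"
    by (auto simp: coset_scale_class[OF vs] intro!: imageI forms.subspace_scale[OF assms])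
  fix T assume "T \<in> cls ` V"
  with S show "S + T \<in> cls ` V"
    by (auto simp: cohom_class_add intro!: imageI forms.subspace_add[OF assms])
qed

text \<open>Subspaces of cohomology are handled through subspaces of forms representing them; a direct
  sum decomposition modulo coboundaries then amounts to the usual spanning and independence
  conditions, both read modulo coboundaries.\<close>

lemma internal_direct_sum_images:
  assumes "Vs \<noteq> []" and Z: "forms.subspace Z"
    and V: "\<And>V. V \<in> set Vs \<Longrightarrow> forms.subspace V \<and> V \<subseteq> Z"
    and span: "\<And>\<gamma>. \<gamma> \<in> Z \<Longrightarrow> \<exists>vs\<in>listset Vs. \<gamma> - sum_list vs \<in> N"
    and indep: "\<And>vs. vs \<in> listset Vs \<Longrightarrow> sum_list vs \<in> N \<Longrightarrow> set vs \<subseteq> N"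
  shows "internal_direct_sum N (cls ` Z) (map ((`) cls) Vs)"
  unfolding internal_direct_sum_def
proof (intro conjI)
  show "map ((`) cls) Vs \<noteq> []" using assms(1) by simp
  show "\<forall>U\<in>set (map ((`) cls) Vs). coset_subspace N U \<and> U \<subseteq> cls ` Z"
    using V coset_subspace_image by auto
  have ne: "vs \<noteq> []" and inZ: "sum_list vs \<in> Z" if "vs \<in> listset Vs" for vs
  proof -
    have l: "list_all2 (\<in>) vs Vs" using that by (simp add: in_listset_iff)
    then show "vs \<noteq> []" using assms(1) by auto
    have "set vs \<subseteq> Z"
      using l V by (fastforce simp: list_all2_conv_all_nth in_set_conv_nth)
    then show "sum_list vs \<in> Z" by (rule sum_list_in_subspace[OF Z])
  qed
  show "bij_betw sum_list (listset (map ((`) cls) Vs)) (cls ` Z)"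
    unfolding bij_betw_def listset_map_image
  proof
    show "inj_on sum_list (map cls ` listset Vs)"
    proof (rule inj_onI, clarify)
      fix vs ws assume vw: "vs \<in> listset Vs" "ws \<in> listset Vs"
        and eq: "sum_list (map cls vs) = sum_list (map cls ws)"
      then have l: "list_all2 (\<in>) vs Vs" "list_all2 (\<in>) ws Vs"
        by (simp_all add: in_listset_iff)
      then have len: "length vs = length ws" "length ws = length Vs"
        by (simp_all add: list_all2_lengthD)
      have d: "map2 (-) vs ws \<in> listset Vs"
        unfolding in_listset_iff
        using l V by (auto simp: list_all2_conv_all_nth intro!: forms.subspace_diff)
      have "sum_list (map2 (-) vs ws) = sum_list vs - sum_list ws"
        using len(1) by (induction vs ws rule: list_induct2) (simp_all add: fun_eq_iff algebra_simps)
      also have "\<dots> \<in> N"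
        using eq ne vw by (simp add: sum_list_cohom_class cohom_class_eq_iff)
      finally have "set (map2 (-) vs ws) \<subseteq> N" by (rule indep[OF d])
      then show "map cls vs = map cls ws"
        using len by (auto simp: list_eq_iff_nth_eq cohom_class_eq_iff set_zip)
    qed
    show "sum_list ` map cls ` listset Vs = cls ` Z"
    proof (intro equalityI subsetI)
      fix S assume "S \<in> sum_list ` map cls ` listset Vs"
      then show "S \<in> cls ` Z" using ne inZ by (auto simp: sum_list_cohom_class)
    next
      fix S assume "S \<in> cls ` Z"
      then obtain \<gamma> where g: "\<gamma> \<in> Z" "S = cls \<gamma>" by auto
      from span[OF g(1)] obtain vs where v: "vs \<in> listset Vs" "\<gamma> - sum_list vs \<in> N" by auto
      then have "S = sum_list (map cls vs)"
        by (simp add: g sum_list_cohom_class ne cohom_class_eq_iff)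
      with v show "S \<in> sum_list ` map cls ` listset Vs" by blast
    qed
  qed
qed

lemma class_line_eq: "class_line s br \<alpha> = cls ` forms.span {\<alpha>}"
  unfolding class_line_def coset_line_def
  by (auto simp: coset_scale_class[OF vs] forms.span_singleton)

lemma one_dimensional_class_line:
  assumes "\<alpha> \<notin> N"
  shows "one_dimensional N (class_line s br \<alpha>)"
  unfolding one_dimensional_def
proof (intro bexI conjI)
  show "cls \<alpha> \<noteq> N"
    using assms cohom_class_eq_iff[of \<alpha> 0] cohom_class_0 by simp
  show "class_line s br \<alpha> = coset_line N (cls \<alpha>)" by (simp add: class_line_def)
  show "cls \<alpha> \<in> class_line s br \<alpha>" by (simp add: class_line_eq forms.span_base)
qed

lemma listset_spans:
  "listset (map (\<lambda>\<alpha>. forms.span {\<alpha>}) \<alpha>s) = {map2 form_scale cs \<alpha>s | cs. length cs = length \<alpha>s}"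
proof (induction \<alpha>s)
  case Nil
  show ?case by simp
next
  case (Cons \<alpha> \<alpha>s)
  show ?case
    unfolding list.map listset.simps Cons.IH
    unfolding set_Cons_def
  proof (intro equalityI subsetI)
    fix vs assume "vs \<in> {x # xs |x xs. x \<in> forms.span {\<alpha>} \<and>
      xs \<in> {map2 form_scale cs \<alpha>s |cs. length cs = length \<alpha>s}}"
    then obtain c cs where "vs = map2 form_scale (c # cs) (\<alpha> # \<alpha>s)" "length cs = length \<alpha>s"
      by (auto simp: forms.span_singleton)
    then show "vs \<in> {map2 form_scale cs (\<alpha> # \<alpha>s) |cs. length cs = length (\<alpha> # \<alpha>s)}"
      by (intro CollectI exI[of _ "c # cs"]) simp
  next
    fix vs assume "vs \<in> {map2 form_scale cs (\<alpha> # \<alpha>s) |cs. length cs = length (\<alpha> # \<alpha>s)}"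
    then obtain cs where "vs = map2 form_scale cs (\<alpha> # \<alpha>s)" "length cs = length (\<alpha> # \<alpha>s)"
      by blast
    then show "vs \<in> {x # xs |x xs. x \<in> forms.span {\<alpha>} \<and>
      xs \<in> {map2 form_scale cs \<alpha>s |cs. length cs = length \<alpha>s}}"
      by (cases cs) (auto simp: forms.span_singleton)
  qed
qed

lemma
  assumes "\<alpha>s \<noteq> []" and Z: "forms.subspace Z" "set \<alpha>s \<subseteq> Z"
    and span: "\<And>\<gamma>. \<gamma> \<in> Z \<Longrightarrow>
      \<exists>cs. length cs = length \<alpha>s \<and> \<gamma> - sum_list (map2 form_scale cs \<alpha>s) \<in> N"
    and indep: "\<And>cs. length cs = length \<alpha>s \<Longrightarrow>
      sum_list (map2 form_scale cs \<alpha>s) \<in> N \<Longrightarrow> set cs \<subseteq> {0}"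
  shows internal_direct_sum_lines: "internal_direct_sum N (cls ` Z) (map (class_line s br) \<alpha>s)"
    and one_dimensional_lines: "\<alpha> \<in> set \<alpha>s \<Longrightarrow> one_dimensional N (class_line s br \<alpha>)"
proof -
  have "internal_direct_sum N (cls ` Z) (map ((`) cls) (map (\<lambda>\<alpha>. forms.span {\<alpha>}) \<alpha>s))"
  proof (rule internal_direct_sum_images)
    show "map (\<lambda>\<alpha>. forms.span {\<alpha>}) \<alpha>s \<noteq> []" using assms(1) by simp
    show "forms.subspace Z" by fact
    show "forms.subspace V \<and> V \<subseteq> Z" if "V \<in> set (map (\<lambda>\<alpha>. forms.span {\<alpha>}) \<alpha>s)" for V
      using that Z by (auto simp: forms.subspace_span dest: forms.span_minimal[rotated])
        (metis forms.span_minimal insert_subset empty_subsetI subset_iff)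
    show "\<exists>vs\<in>listset (map (\<lambda>\<alpha>. forms.span {\<alpha>}) \<alpha>s). \<gamma> - sum_list vs \<in> N" if "\<gamma> \<in> Z" for \<gamma>
      using span[OF that] unfolding listset_spans by blast
    fix vs assume v: "vs \<in> listset (map (\<lambda>\<alpha>. forms.span {\<alpha>}) \<alpha>s)" "sum_list vs \<in> N"
    then obtain cs where cs: "vs = map2 form_scale cs \<alpha>s" "length cs = length \<alpha>s"
      unfolding listset_spans by blast
    with v indep have "set cs \<subseteq> {0}" by blast
    then have "set vs \<subseteq> {0}"
      unfolding cs by (auto dest!: set_zip_leftD)
    then show "set vs \<subseteq> N"
      using forms.subspace_0[OF N_subspace] by blast
  qed
  then show "internal_direct_sum N (cls ` Z) (map (class_line s br) \<alpha>s)"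
    by (simp add: class_line_eq[abs_def] comp_def)
  assume "\<alpha> \<in> set \<alpha>s"
  then obtain \<beta>s \<gamma>s where split: "\<alpha>s = \<beta>s @ \<alpha> # \<gamma>s" by (meson split_list)
  define cs :: "complex list" where "cs = replicate (length \<beta>s) 0 @ 1 # replicate (length \<gamma>s) 0"
  have zero: "sum_list (map2 form_scale (replicate (length \<delta>s) 0) \<delta>s) = 0" for \<delta>s :: "'g form list"
    by (induction \<delta>s) simp_all
  have "sum_list (map2 form_scale cs \<alpha>s) = \<alpha>"
    by (simp add: cs_def split zero)
  moreover have "length cs = length \<alpha>s" "\<not> set cs \<subseteq> {0}"
    by (auto simp: cs_def split)
  ultimately have "\<alpha> \<notin> N" using indep by metis
  then show "one_dimensional N (class_line s br \<alpha>)" by (rule one_dimensional_class_line)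
qed

end

section \<open>Leibniz cocycles and Lie cocycles\<close>

lemma bilinear_form_iff:
  assumes "vector_space s"
  shows "bilinear_form s \<alpha> \<longleftrightarrow> (\<forall>x y z. \<alpha> x (y + z) = \<alpha> x y + \<alpha> x z) \<and>
    (\<forall>x y z. \<alpha> (x + y) z = \<alpha> x z + \<alpha> y z) \<and>
    (\<forall>c x y. \<alpha> x (s c y) = c * \<alpha> x y) \<and> (\<forall>c x y. \<alpha> (s c x) y = c * \<alpha> x y)"
  using assms vector_space_times
  unfolding bilinear_form_def Vector_Spaces.linear_iff by blast

lemma bilinear_form_combination:
  assumes "vector_space s" "bilinear_form s \<alpha>" "bilinear_form s \<beta>"
  shows "bilinear_form s (\<lambda>x y. a * \<alpha> x y + b * \<beta> x y)"
  unfolding bilinear_form_iff[OF assms(1)]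
  using assms(2,3)[unfolded bilinear_form_iff[OF assms(1)]] by (simp add: distrib_left)

lemma leibniz_cocycleD:
  assumes "\<alpha> \<in> leibniz_cocycles s br"
  shows "bilinear_form s \<alpha>" and "\<alpha> (br x y) z = \<alpha> x (br y z) + \<alpha> (br x z) y"
proof -
  have *: "bilinear_form s \<alpha> \<and> (\<forall>x y z. \<alpha> (br x y) z = \<alpha> x (br y z) + \<alpha> (br x z) y)"
    using assms unfolding leibniz_cocycles_def mem_Collect_eq .
  from * show "bilinear_form s \<alpha>" ..
  show "\<alpha> (br x y) z = \<alpha> x (br y z) + \<alpha> (br x z) y"
    by (rule conjunct2[OF *, rule_format])
qed

lemma leibniz_cocycles_subspace:
  assumes s: "vector_space s"
  shows "forms.subspace (leibniz_cocycles s br)"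
proof -
  have "bilinear_form s 0"
    unfolding bilinear_form_iff[OF s] by simp
  then have zero: "0 \<in> leibniz_cocycles s br"
    by (simp add: leibniz_cocycles_def)
  have comb: "(\<lambda>x y. a * \<alpha> x y + b * \<beta> x y) \<in> leibniz_cocycles s br"
    if "\<alpha> \<in> leibniz_cocycles s br" "\<beta> \<in> leibniz_cocycles s br" for a b \<alpha> \<beta>
  proof -
    have "a * \<alpha> (br x y) z + b * \<beta> (br x y) z = a * \<alpha> x (br y z) + b * \<beta> x (br y z)
        + (a * \<alpha> (br x z) y + b * \<beta> (br x z) y)" for x y z
      by (subst leibniz_cocycleD(2)[OF that(1)], subst leibniz_cocycleD(2)[OF that(2)])
        (simp add: distrib_left)
    then show ?thesis
      unfolding leibniz_cocycles_def
      by (intro CollectI conjI allI bilinear_form_combination[OF s] leibniz_cocycleD(1)[OF that(1)]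
        leibniz_cocycleD(1)[OF that(2)])
  qed
  show ?thesis
  proof (rule forms.subspaceI[OF zero])
    fix \<alpha> \<beta> c assume \<alpha>: "\<alpha> \<in> leibniz_cocycles s br"
    show "form_scale c \<alpha> \<in> leibniz_cocycles s br"
      using comb[OF \<alpha> \<alpha>, of c 0] by (simp add: form_scale_def)
    assume \<beta>: "\<beta> \<in> leibniz_cocycles s br"
    have "\<alpha> + \<beta> = (\<lambda>x y. 1 * \<alpha> x y + 1 * \<beta> x y)" by (simp add: fun_eq_iff)
    then show "\<alpha> + \<beta> \<in> leibniz_cocycles s br"
      by (simp only: comb[OF \<alpha> \<beta>])
  qed
qed

lemma invariant_symmetric_formD:
  assumes "invariant_symmetric_form s br \<theta>"
  shows "bilinear_form s \<theta>" "\<theta> u v = \<theta> v u" "\<theta> (br x u) v + \<theta> u (br x v) = 0"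
  using assms unfolding invariant_symmetric_form_def by blast+

context lie_algebra
begin

lemma br_antisym: "br x y = - br y x"
proof -
  have "br (x + y) (x + y) = br x x + br x y + (br y x + br y y)"
    using linear_right linear_left unfolding Vector_Spaces.linear_iff by metis
  then show ?thesis by (simp add: alternating eq_neg_iff_add_eq_0)
qed

lemma bilinear_form_neg:
  assumes "bilinear_form scale \<alpha>"
  shows "\<alpha> (- x) y = - \<alpha> x y" "\<alpha> x (- y) = - \<alpha> x y"
proof -
  have "\<alpha> (scale (- 1) x) y = - 1 * \<alpha> x y" "\<alpha> x (scale (- 1) y) = - 1 * \<alpha> x y"
    using assms unfolding bilinear_form_iff[OF vector_space_axioms] by blast+
  then show "\<alpha> (- x) y = - \<alpha> x y" "\<alpha> x (- y) = - \<alpha> x y" by simp_all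
qed

lemma alternating_form_antisym:
  assumes "bilinear_form scale \<alpha>" "\<And>x. \<alpha> x x = 0"
  shows "\<alpha> x y = - \<alpha> y x"
proof -
  have "\<alpha> (x + y) (x + y) = \<alpha> x x + \<alpha> x y + (\<alpha> y x + \<alpha> y y)"
    using assms(1) unfolding bilinear_form_iff[OF vector_space_axioms] by metis
  then show ?thesis by (simp add: assms(2) eq_neg_iff_add_eq_0)
qed

text \<open>For an alternating form, moving the arguments of the Jacobi-type identity into place turns it
  into the Leibniz identity, so the two notions of cocycle differ only in the alternation.\<close>

lemma lie_cocycles_eq:
  "lie_cocycles scale br = {\<alpha> \<in> leibniz_cocycles scale br. \<forall>x. \<alpha> x x = 0}"
proof -
  have "(\<alpha> (br x y) z + \<alpha> (br y z) x + \<alpha> (br z x) y = 0) \<longleftrightarrow>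
      (\<alpha> (br x y) z = \<alpha> x (br y z) + \<alpha> (br x z) y)"
    if "bilinear_form scale \<alpha>" "\<forall>x. \<alpha> x x = 0" for \<alpha> x y z
  proof -
    have "\<alpha> (br y z) x = - \<alpha> x (br y z)" "\<alpha> (br z x) y = - \<alpha> (br x z) y"
      using alternating_form_antisym[of \<alpha> "br y z" x] that br_antisym[of z x]
      by (simp_all add: bilinear_form_neg)
    then show ?thesis by (simp add: algebra_simps)
  qed
  then show ?thesis
    unfolding lie_cocycles_def leibniz_cocycles_def by blast
qed

lemma lie_cocycles_subspace: "forms.subspace (lie_cocycles scale br)"
proof -
  have alt: "forms.subspace {\<alpha> :: 'g form. \<forall>x. \<alpha> x x = 0}"
    by (rule forms.subspaceI) (simp_all add: form_scale_def)
  have "lie_cocycles scale br = leibniz_cocycles scale br \<inter> {\<alpha>. \<forall>x. \<alpha> x x = 0}"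
    by (simp only: lie_cocycles_eq Int_def mem_Collect_eq)
  then show ?thesis
    using forms.subspace_inter[OF leibniz_cocycles_subspace[OF vector_space_axioms, of br] alt]
    by simp
qed

text \<open>The Leibniz identities for \<open>(u, x, v)\<close> and \<open>(v, x, u)\<close> contain the terms \<open>\<alpha> [u, v] x\<close> and
  \<open>\<alpha> [v, u] x\<close>, which cancel in the sum; what is left is the invariance.\<close>

lemma leibniz_cocycle_symmetrization:
  assumes "\<alpha> \<in> leibniz_cocycles scale br"
  shows "invariant_symmetric_form scale br (\<lambda>x y. \<alpha> x y + \<alpha> y x)"
proof -
  have bil: "bilinear_form scale \<alpha>"
    and leib: "\<And>x y z. \<alpha> (br x y) z = \<alpha> x (br y z) + \<alpha> (br x z) y"
    by (rule leibniz_cocycleD[OF assms])+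
  have "bilinear_form scale (\<lambda>x y. \<alpha> x y + \<alpha> y x)"
    using bil unfolding bilinear_form_iff[OF vector_space_axioms] by (simp add: algebra_simps)
  moreover have "\<alpha> (br x u) v + \<alpha> v (br x u) + (\<alpha> u (br x v) + \<alpha> (br x v) u) = 0" for x u v
  proof -
    have "\<alpha> (- br x u) v = \<alpha> u (br x v) + \<alpha> (br u v) x"
      using leib[of u x v] by (simp only: br_antisym[of u x])
    then have 1: "\<alpha> (br x u) v = - \<alpha> u (br x v) - \<alpha> (br u v) x"
      by (simp add: bilinear_form_neg[OF bil] minus_equation_iff[of "\<alpha> (br x u) v"])
    have "\<alpha> (- br x v) u = \<alpha> v (br x u) + \<alpha> (- br u v) x"
      using leib[of v x u] by (simp only: br_antisym[of v x] br_antisym[of v u])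
    then have 2: "\<alpha> (br x v) u = - \<alpha> v (br x u) + \<alpha> (br u v) x"
      by (simp add: bilinear_form_neg[OF bil] minus_equation_iff[of "\<alpha> (br x v) u"])
    show ?thesis by (simp add: 1 2)
  qed
  ultimately show ?thesis
    unfolding invariant_symmetric_form_def by (simp add: add.commute)
qed

text \<open>An invariant form has \<open>\<theta> [x, y] z\<close> totally antisymmetric, and the Leibniz identity asks exactly
  that this 3-form vanish.\<close>

lemma invariant_form_leibniz_cocycle:
  assumes "invariant_symmetric_form scale br \<theta>" and "\<And>x y z. \<theta> (br x y) z = 0"
  shows "\<theta> \<in> leibniz_cocycles scale br"
proof -
  have "\<theta> x (br y z) = 0" for x y z
    using assms(2)[of y z x] assms(1) unfolding invariant_symmetric_form_def by auto
  moreover have "bilinear_form scale \<theta>"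
    using assms(1) by (simp add: invariant_symmetric_form_def)
  ultimately show ?thesis
    by (simp add: assms(2) leibniz_cocycles_def)
qed

lemma coboundaries_subset_lie_cocycles: "coboundaries scale br \<subseteq> lie_cocycles scale br"
proof
  fix \<alpha> assume "\<alpha> \<in> coboundaries scale br"
  then obtain f where f: "Vector_Spaces.linear scale (*) f" "\<alpha> = (\<lambda>x y. f (br x y))"
    by (auto simp: coboundaries_def)
  interpret f: Vector_Spaces.linear scale "(*)" f by (rule f(1))
  have "bilinear_form scale \<alpha>"
    unfolding bilinear_form_iff[OF vector_space_axioms] f(2)
    using linear_right linear_left unfolding Vector_Spaces.linear_iff
    by (simp add: f.add f.scale)
  moreover have "f (br (br x y) z) + f (br (br y z) x) + f (br (br z x) y) = 0" for x y z
  proof -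
    have "br (br x y) z + br (br y z) x + br (br z x) y =
        - (br x (br y z) + br y (br z x) + br z (br x y))"
      by (simp add: br_antisym[of "br x y" z] br_antisym[of "br y z" x] br_antisym[of "br z x" y])
    then have "br (br x y) z + br (br y z) x + br (br z x) y = 0" by (simp only: jacobi minus_zero)
    then have "f (br (br x y) z + br (br y z) x + br (br z x) y) = 0" by (simp add: f.zero)
    then show ?thesis by (simp only: f.add)
  qed
  ultimately show "\<alpha> \<in> lie_cocycles scale br"
    unfolding lie_cocycles_def f(2) by (simp add: alternating f.zero)
qed

end

section \<open>Forms on an extension of the Witt algebra by a graded module\<close>

definition eL :: "int \<Rightarrow> wspace" where "eL n = (Poly_Mapping.single n 1, 0)"
definition eX :: "int \<Rightarrow> wspace" where "eX n = (0, Poly_Mapping.single n 1)"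

lemma vector_space_wscale: "vector_space wscale"
  by (intro vector_space_prod_scale vector_space_zscale)

lemmas bilinear_form_wscale_iff = bilinear_form_iff[OF vector_space_wscale]

lemma bilinear_ext_0 [simp]: "bilinear_ext s b 0 y = 0" "bilinear_ext s b x 0 = 0"
  by (simp_all add: bilinear_ext_def)

lemma bilinear_ext_linear:
  "bilinear_ext (*) b x (y + z) = bilinear_ext (*) b x y + bilinear_ext (*) b x z"
  "bilinear_ext (*) b (x + y) z = bilinear_ext (*) b x z + bilinear_ext (*) b y z"
  "bilinear_ext (*) b x (zscale c y) = c * bilinear_ext (*) b x y"
  "bilinear_ext (*) b (zscale c x) y = c * bilinear_ext (*) b x y"
  using linear_bilinear_ext_right[OF vector_space_times, of b x]
    linear_bilinear_ext_left[OF vector_space_times, of b z]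
    linear_bilinear_ext_left[OF vector_space_times, of b y]
  unfolding Vector_Spaces.linear_iff by blast+

lemma zscale_0 [simp]: "zscale c 0 = 0"
  by (rule poly_mapping_eqI) simp

lemma wspace_linear_eqI:
  assumes f: "Vector_Spaces.linear wscale (*) f" and g: "Vector_Spaces.linear wscale (*) g"
    and eq: "\<And>n. f (eL n) = g (eL n)" "\<And>n. f (eX n) = g (eX n)"
  shows "f x = g x"
proof -
  have lin: "Vector_Spaces.linear zscale (*) (\<lambda>u. h (u, 0))"
    "Vector_Spaces.linear zscale (*) (\<lambda>u. h (0, u))"
    "h x = h (fst x, 0) + h (0, snd x)"
    if h: "Vector_Spaces.linear wscale (*) h" for h
  proof -
    interpret h: Vector_Spaces.linear wscale "(*)" h by (rule h)
    show "Vector_Spaces.linear zscale (*) (\<lambda>u. h (u, 0))"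
      "Vector_Spaces.linear zscale (*) (\<lambda>u. h (0, u))"
      using h.add[of "(_, 0)" "(_, 0)"] h.add[of "(0, _)" "(0, _)"]
        h.scale[of _ "(_, 0)"] h.scale[of _ "(0, _)"]
      by (auto intro!: linearI'[OF vector_space_zscale vector_space_times]
          simp: prod_scale_def)
    show "h x = h (fst x, 0) + h (0, snd x)"
      by (simp flip: h.add)
  qed
  have "f (fst x, 0) = g (fst x, 0)"
    by (rule zspace_linear_eqI[OF lin(1)[OF f] lin(1)[OF g]]) (use eq(1) in \<open>simp add: eL_def\<close>)
  moreover have "f (0, snd x) = g (0, snd x)"
    by (rule zspace_linear_eqI[OF lin(2)[OF f] lin(2)[OF g]]) (use eq(2) in \<open>simp add: eX_def\<close>)
  ultimately show ?thesis by (simp add: lin(3)[OF f] lin(3)[OF g])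
qed

lemma bilinear_form_eqI:
  assumes \<alpha>: "bilinear_form wscale \<alpha>" and \<beta>: "bilinear_form wscale \<beta>"
    and "\<And>n m. \<alpha> (eL n) (eL m) = \<beta> (eL n) (eL m)" "\<And>n m. \<alpha> (eL n) (eX m) = \<beta> (eL n) (eX m)"
    and "\<And>n m. \<alpha> (eX n) (eL m) = \<beta> (eX n) (eL m)" "\<And>n m. \<alpha> (eX n) (eX m) = \<beta> (eX n) (eX m)"
  shows "\<alpha> = \<beta>"
proof (intro ext)
  fix x y
  have lin: "Vector_Spaces.linear wscale (*) (\<gamma> u)" "Vector_Spaces.linear wscale (*) (\<lambda>u. \<gamma> u v)"
    if "bilinear_form wscale \<gamma>" for \<gamma> u v
    using that[unfolded bilinear_form_def] by (simp_all del: split_paired_All)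
  have left: "\<alpha> (eL n) y = \<beta> (eL n) y" "\<alpha> (eX n) y = \<beta> (eX n) y" for n
    by (rule wspace_linear_eqI[OF lin(1)[OF \<alpha>] lin(1)[OF \<beta>]]; rule assms)+
  show "\<alpha> x y = \<beta> x y"
    by (rule wspace_linear_eqI[OF lin(2)[OF \<alpha>] lin(2)[OF \<beta>]]) (rule left)+
qed

text \<open>The linear functional with prescribed values on the basis; any choice is possible because the
  elements are finite combinations of the basis. It is obtained as a partially evaluated
  \<open>bilinear_ext\<close> so that the linearity of the latter can be reused.\<close>

definition functional :: "(int \<Rightarrow> complex) \<Rightarrow> (int \<Rightarrow> complex) \<Rightarrow> wspace \<Rightarrow> complex" where
  "functional \<phi> \<psi> p = bilinear_ext (*) (\<lambda>_. \<phi>) (Poly_Mapping.single 0 1) (fst p) +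
     bilinear_ext (*) (\<lambda>_. \<psi>) (Poly_Mapping.single 0 1) (snd p)"

lemma functional_basis [simp]: "functional \<phi> \<psi> (eL n) = \<phi> n" "functional \<phi> \<psi> (eX n) = \<psi> n"
  by (simp_all add: functional_def eL_def eX_def vector_space_times del: single_one)

lemma linear_functional: "Vector_Spaces.linear wscale (*) (functional \<phi> \<psi>)"
  by (rule linearI'[OF vector_space_wscale vector_space_times])
    (simp_all add: functional_def prod_scale_def bilinear_ext_linear algebra_simps)

lemma antisym_form_basis [simp]:
  "antisym_form ll lx xx (eL n) (eL m) = ll n m"
  "antisym_form ll lx xx (eL n) (eX m) = lx n m"
  "antisym_form ll lx xx (eX m) (eL n) = - lx n m"
  "antisym_form ll lx xx (eX n) (eX m) = xx n m"
  by (simp_all add: antisym_form_def eL_def eX_def vector_space_times del: single_one)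

lemma bilinear_antisym_form: "bilinear_form wscale (antisym_form ll lx xx)"
  unfolding bilinear_form_wscale_iff
  by (simp add: antisym_form_def prod_scale_def bilinear_ext_linear algebra_simps)

lemma alternating_antisym_form:
  assumes "\<And>n m. ll n m = - ll m n" "\<And>n m. xx n m = - xx m n"
  shows "antisym_form ll lx xx x x = 0"
proof -
  let ?\<alpha> = "antisym_form ll lx xx"
  have "?\<alpha> = (\<lambda>x y. - ?\<alpha> y x)"
  proof (rule bilinear_form_eqI[OF bilinear_antisym_form])
    show "bilinear_form wscale (\<lambda>x y. - ?\<alpha> y x)"
      using bilinear_antisym_form[of ll lx xx] unfolding bilinear_form_wscale_iff by simp
  qed (simp_all only: antisym_form_basis minus_minus assms(1)[symmetric] assms(2)[symmetric])
  from fun_cong[OF fun_cong[OF this, of x], of x] have "?\<alpha> x x = - ?\<alpha> x x" .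
  then show ?thesis by simp
qed

definition extension_bracket :: "(int \<Rightarrow> int \<Rightarrow> complex) \<Rightarrow> wspace \<Rightarrow> wspace \<Rightarrow> wspace" where
  "extension_bracket c =
     semidirect witt (bilinear_ext zscale (\<lambda>n m. Poly_Mapping.single (n + m) (c n m)))"

text \<open>Common setting for A and B: a graded module with one-dimensional components and structure
  constants \<open>c\<close>, on which \<open>L\<^sub>0\<close> acts by the degree.\<close>

locale witt_extension =
  fixes c :: "int \<Rightarrow> int \<Rightarrow> complex"
  assumes lie: "lie_algebra wscale (extension_bracket c)"
    and weight: "c 0 m = of_int m"
begin

sublocale lie_algebra wscale "extension_bracket c" by (rule lie)

abbreviation "br \<equiv> extension_bracket c"

lemma br_basis [simp]:
  "br (eL n) (eL m) = wscale (of_int (m - n)) (eL (n + m))"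
  "br (eL n) (eX m) = wscale (c n m) (eX (n + m))"
  "br (eX m) (eL n) = wscale (- c n m) (eX (n + m))"
  "br (eX n) (eX m) = 0"
  by (simp_all add: extension_bracket_def semidirect_def eL_def eX_def witt_single prod_scale_def
      vector_space_zscale zero_prod_def witt_def single_uminus)

lemma br_linear: "br (x + y) z = br x z + br y z" "br z (x + y) = br z x + br z y"
  "br (wscale a x) z = wscale a (br x z)" "br z (wscale a x) = wscale a (br z x)"
  using linear_left linear_right unfolding Vector_Spaces.linear_iff by blast+

text \<open>The cocycle expression is invariant under cyclic permutation of its arguments, so linearity in
  the first argument is enough to reduce to basis vectors, and of the eight types of basis triples
  only those up to rotation have to be checked.\<close>

lemma cocycle_on_basis:
  assumes bil: "bilinear_form wscale \<alpha>"
  defines "J \<equiv> \<lambda>x y z. \<alpha> (br x y) z + \<alpha> (br y z) x + \<alpha> (br z x) y"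
  assumes LLL: "\<And>n m k. J (eL n) (eL m) (eL k) = 0" and LLX: "\<And>n m k. J (eL n) (eL m) (eX k) = 0"
    and LXX: "\<And>n m k. J (eL n) (eX m) (eX k) = 0"
  shows "J x y z = 0"
proof -
  note b = bil[unfolded bilinear_form_wscale_iff]
  have cyc: "J x y z = J y z x" for x y z by (simp add: J_def)
  have lin: "Vector_Spaces.linear wscale (*) (\<lambda>x. J x y z)" for y z
    by (rule linearI'[OF vector_space_wscale vector_space_times])
      (simp_all add: J_def b br_linear algebra_simps)
  have zero: "Vector_Spaces.linear wscale (*) (\<lambda>_. 0)"
    by (rule linearI'[OF vector_space_wscale vector_space_times]) simp_all
  have ext: "J x y z = 0" if "\<And>n. J (eL n) y z = 0" "\<And>n. J (eX n) y z = 0" for x y z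
    by (rule wspace_linear_eqI[OF lin zero]) (rule that)+
  have "\<alpha> 0 u = 0" for u using b[THEN conjunct2, THEN conjunct2, THEN conjunct2, rule_format, of 0 0 u]
    by (simp add: prod_scale_def zero_prod_def)
  then have XXX: "J (eX n) (eX m) (eX k) = 0" for n m k by (simp add: J_def)
  have cyc': "J x y z = J z x y" for x y z by (simp add: J_def)
  have LXL: "J (eL n) (eX m) (eL k) = 0" and XXL: "J (eX n) (eX m) (eL k) = 0" for n m k
    using LLX[of k n m] LXX[of k n m] by (simp_all only: cyc'[of _ _ "eL k"])
  have XLL: "J (eX n) (eL m) (eL k) = 0" and XLX: "J (eX n) (eL m) (eX k) = 0" for n m k
    using LLX[of m k n] LXX[of m k n] by (simp_all only: cyc[of "eX n"])
  have two: "J (eL n) (eL m) z = 0" "J (eL n) (eX m) z = 0"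
    "J (eX n) (eL m) z = 0" "J (eX n) (eX m) z = 0" for n m z
    by (subst cyc', (rule ext; rule LLL LLX LXL LXX XLL XLX XXL XXX))+
  have one: "J z (eL n) y = 0" "J z (eX n) y = 0" for n y z
    by (subst cyc', (rule ext; (subst cyc', rule two)))+
  show ?thesis by (rule ext; (subst cyc', rule one))
qed

lemma antisym_form_lie_cocycle:
  assumes anti: "\<And>n m. ll n m = - ll m n" "\<And>n m. xx n m = - xx m n"
    and LLL: "\<And>n m k. of_int (m - n) * ll (n + m) k + of_int (k - m) * ll (m + k) n
      + of_int (n - k) * ll (k + n) m = 0"
    and LLX: "\<And>n m k. of_int (m - n) * lx (n + m) k - c m k * lx n (m + k) + c n k * lx m (n + k) = 0"
    and LXX: "\<And>n m k. c n m * xx (n + m) k + c n k * xx m (n + k) = 0"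
  shows "antisym_form ll lx xx \<in> lie_cocycles wscale br"
proof -
  note bil = bilinear_antisym_form[of ll lx xx]
  note b = bil[unfolded bilinear_form_wscale_iff]
  have zero: "antisym_form ll lx xx 0 u = 0" for u
    by (simp add: antisym_form_def zero_prod_def)
  show ?thesis
    unfolding lie_cocycles_def
  proof (intro CollectI conjI allI bil alternating_antisym_form anti)
    fix x y z
    show "antisym_form ll lx xx (br x y) z + antisym_form ll lx xx (br y z) x +
        antisym_form ll lx xx (br z x) y = 0"
    proof (rule cocycle_on_basis[OF bil])
      fix n m k
      show "antisym_form ll lx xx (br (eL n) (eL m)) (eL k) +
          antisym_form ll lx xx (br (eL m) (eL k)) (eL n) +
          antisym_form ll lx xx (br (eL k) (eL n)) (eL m) = 0"
        using LLL[of m n k] by (simp add: b bilinear_form_neg[OF bil])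
      show "antisym_form ll lx xx (br (eL n) (eL m)) (eX k) +
          antisym_form ll lx xx (br (eL m) (eX k)) (eL n) +
          antisym_form ll lx xx (br (eX k) (eL n)) (eL m) = 0"
        using LLX[of m n k] by (simp add: b bilinear_form_neg[OF bil])
      show "antisym_form ll lx xx (br (eL n) (eX m)) (eX k) +
          antisym_form ll lx xx (br (eX m) (eX k)) (eL n) +
          antisym_form ll lx xx (br (eX k) (eL n)) (eX m) = 0"
        using LXX[of n m k] anti(2)[of m "n + k"] by (simp add: b zero bilinear_form_neg[OF bil])
    qed
  qed
qed

end

section \<open>Reduction to degree zero\<close>

text \<open>The antisymmetric form of total degree zero; \<open>f\<close>, \<open>g\<close>, \<open>h\<close> are its values on
  \<open>(L\<^sub>n, L\<^sub>-\<^sub>n)\<close>, \<open>(L\<^sub>n, X\<^sub>-\<^sub>n)\<close> and \<open>(X\<^sub>n, X\<^sub>-\<^sub>n)\<close>.\<close>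

definition graded_form ::
    "(int \<Rightarrow> complex) \<Rightarrow> (int \<Rightarrow> complex) \<Rightarrow> (int \<Rightarrow> complex) \<Rightarrow> wspace form" where
  "graded_form f g h = antisym_form (\<lambda>n m. if n + m = 0 then f n else 0)
     (\<lambda>n m. if n + m = 0 then g n else 0) (\<lambda>n m. if n + m = 0 then h n else 0)"

context witt_extension
begin

text \<open>Eigenvectors of a skew operator are orthogonal unless their eigenvalues are opposite; here the
  operator is the bracket with \<open>L\<^sub>0\<close>.\<close>

lemma invariant_form_weight:
  assumes \<theta>: "invariant_symmetric_form wscale br \<theta>"
    and "br (eL 0) u = wscale (of_int i) u" "br (eL 0) v = wscale (of_int j) v" "i + j \<noteq> 0"
  shows "\<theta> u v = 0"
proof -
  have "bilinear_form wscale \<theta>" "\<theta> (br (eL 0) u) v + \<theta> u (br (eL 0) v) = 0"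
    by (rule invariant_symmetric_formD[OF \<theta>])+
  then have "of_int (i + j) * \<theta> u v = 0"
    by (simp only: bilinear_form_wscale_iff assms(2,3) of_int_add distrib_right)
  then show ?thesis using assms(4) by (simp del: of_int_add)
qed

lemma br_eL_0: "br (eL 0) (eL n) = wscale (of_int n) (eL n)" "br (eL 0) (eX n) = wscale (of_int n) (eX n)"
  by (simp_all add: weight)

text \<open>Invariance under \<open>L\<^sub>n\<close>, applied to the pair \<open>(L\<^sub>n, X\<^sub>-\<^sub>2\<^sub>n)\<close>, involves \<open>[L\<^sub>n, L\<^sub>n] = 0\<close> and
  leaves \<open>c n (-2n) \<theta>(L\<^sub>n, X\<^sub>-\<^sub>n) = 0\<close>; this is the reason for the hypothesis on \<open>c\<close>. For
  \<open>X = L\<close> the corresponding coefficient is \<open>-3n\<close>. The value in degree zero is then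
  determined by degrees \<open>1\<close> and \<open>-1\<close>.\<close>

lemma invariant_form_LL_LX:
  assumes \<theta>: "invariant_symmetric_form wscale br \<theta>" and c: "\<And>n. n \<noteq> 0 \<Longrightarrow> c n (- 2 * n) \<noteq> 0"
  shows "\<theta> (eL n) (eL m) = 0" and "\<theta> (eL n) (eX m) = 0"
proof -
  have bil: "bilinear_form wscale \<theta>" and sym: "\<And>u v. \<theta> u v = \<theta> v u"
    and inv: "\<And>x u v. \<theta> (br x u) v + \<theta> u (br x v) = 0"
    by (rule invariant_symmetric_formD[OF \<theta>])+
  note b = bil[unfolded bilinear_form_wscale_iff]
  note off = invariant_form_weight[OF \<theta> br_eL_0(1) br_eL_0(1)]
    invariant_form_weight[OF \<theta> br_eL_0(1) br_eL_0(2)]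
  have LL: "\<theta> (eL k) (eL (- k)) = 0" for k
  proof -
    have 1: "of_int (m - n) * \<theta> (eL (n + m)) (eL (- n - m)) +
        of_int (- n - m - n) * \<theta> (eL m) (eL (- m)) = 0" for n m
      using inv[of "eL n" "eL m" "eL (- n - m)"] by (simp add: b)
    from 1[of 0 1] 1[of 1 1] have "\<theta> (eL 1) (eL (- 1)) = 0" by simp
    with 1[of "- 1" 1] sym[of "eL (- 1)" "eL 1"] have zero: "\<theta> (eL 0) (eL 0) = 0" by simp
    then show ?thesis using 1[of 0 k] 1[of k 0] by (cases "k = 0") simp_all
  qed
  show "\<theta> (eL n) (eL m) = 0"
    by (cases "n + m = 0") (use LL[of n] in \<open>simp add: minus_unique\<close>, rule off(1))
  have LX: "\<theta> (eL k) (eX (- k)) = 0" for k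
  proof -
    have 1: "of_int (m - n) * \<theta> (eL (n + m)) (eX (- n - m)) +
        c n (- n - m) * \<theta> (eL m) (eX (- m)) = 0" for n m
      using inv[of "eL n" "eL m" "eX (- n - m)"] by (simp add: b)
    have nz: "\<theta> (eL k) (eX (- k)) = 0" if "k \<noteq> 0" for k
      using 1[of k k] c[OF that] by simp
    from 1[of "- 1" 1] nz[of 1] nz[of "- 1"] have "\<theta> (eL 0) (eX 0) = 0" by simp
    with nz show ?thesis by (cases "k = 0") simp_all
  qed
  show "\<theta> (eL n) (eX m) = 0"
    by (cases "n + m = 0") (use LX[of n] in \<open>simp add: minus_unique\<close>, rule off(2))
qed

text \<open>The invariance condition for a form of degree zero on the module with values \<open>h n\<close> on
  \<open>(X\<^sub>n, X\<^sub>-\<^sub>n)\<close>, symmetric or not.\<close>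

definition invariant_pairing :: "(int \<Rightarrow> complex) \<Rightarrow> bool" where
  "invariant_pairing h \<longleftrightarrow> (\<forall>n m. c n m * h (n + m) + c n (- n - m) * h m = 0)"

text \<open>The cocycle condition on \<open>(L\<^sub>n, L\<^sub>m, X\<^sub>-\<^sub>n\<^sub>-\<^sub>m)\<close> for a form of degree zero with values \<open>g n\<close> on
  \<open>(L\<^sub>n, X\<^sub>-\<^sub>n)\<close>.\<close>

definition mixed_cocycle :: "(int \<Rightarrow> complex) \<Rightarrow> bool" where
  "mixed_cocycle g \<longleftrightarrow>
     (\<forall>n m. of_int (m - n) * g (n + m) - c m (- n - m) * g n + c n (- n - m) * g m = 0)"

lemma invariant_form_XX:
  assumes \<theta>: "invariant_symmetric_form wscale br \<theta>"
  shows "n + m \<noteq> 0 \<Longrightarrow> \<theta> (eX n) (eX m) = 0" and "invariant_pairing (\<lambda>n. \<theta> (eX n) (eX (- n)))"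
proof -
  show "n + m \<noteq> 0 \<Longrightarrow> \<theta> (eX n) (eX m) = 0"
    by (rule invariant_form_weight[OF \<theta> br_eL_0(2) br_eL_0(2)])
  have bil: "bilinear_form wscale \<theta>"
    and inv: "\<And>x u v. \<theta> (br x u) v + \<theta> u (br x v) = 0"
    by (rule invariant_symmetric_formD[OF \<theta>])+
  note b = bil[unfolded bilinear_form_wscale_iff]
  show "invariant_pairing (\<lambda>n. \<theta> (eX n) (eX (- n)))"
    unfolding invariant_pairing_def
  proof (intro allI)
    fix n m
    show "c n m * \<theta> (eX (n + m)) (eX (- (n + m))) + c n (- n - m) * \<theta> (eX m) (eX (- m)) = 0"
      using inv[of "eL n" "eX m" "eX (- n - m)"] by (simp add: b)
  qed
qed

end

text \<open>The recursions below express the value at \<open>n + 1\<close> through the one at \<open>n\<close> with a coefficient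
  \<open>n - 1\<close>, so they say nothing on the passage from \<open>1\<close> to \<open>2\<close>, and likewise from \<open>-1\<close> to \<open>-2\<close>.
  The four values nearest to zero have to be supplied.\<close>

lemma int_induct_from_two [consumes 1, case_names one two minus_one minus_two up down]:
  fixes P :: "int \<Rightarrow> bool"
  assumes "n \<noteq> 0" and "P 1" "P 2" "P (- 1)" "P (- 2)" and up: "\<And>n. n \<ge> 2 \<Longrightarrow> P n \<Longrightarrow> P (n + 1)"
    and down: "\<And>n. n \<ge> 2 \<Longrightarrow> P (- n) \<Longrightarrow> P (- n - 1)"
  shows "P n"
proof -
  have pos: "P k" if "k \<ge> 2" for k
    using that by (induction k rule: int_ge_induct) (use assms in auto)
  have neg: "P (- k)" if "k \<ge> 2" for k
    using that by (induction k rule: int_ge_induct) (use assms(5) down in auto)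
  consider "n = 1" | "n = - 1" | "n \<ge> 2" | "- n \<ge> 2" using \<open>n \<noteq> 0\<close> by linarith
  then show ?thesis by cases (use assms(2,4) pos[of n] neg[of "- n"] in auto)
qed

text \<open>The cubic \<open>n(n\<^sup>2 - 1)\<close> solves the same recursion and takes the value \<open>6\<close> at \<open>2\<close>. Subtracting the
  right multiple of it leaves an odd solution vanishing at \<open>1\<close> and \<open>2\<close>, hence everywhere.\<close>

lemma witt_cocycle_values:
  fixes f :: "int \<Rightarrow> complex"
  assumes odd: "\<And>n. f (- n) = - f n" and "f 1 = 0"
    and rec: "\<And>n m. of_int (m - n) * f (n + m) + of_int (- n - m - m) * f (- n)
      + of_int (n + n + m) * f (- m) = 0"
  shows "f n = f 2 / 6 * of_int (n * (n\<^sup>2 - 1))"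
proof -
  define t where "t = f 2 / 6"
  have f2: "f 2 = 6 * t" by (simp add: t_def)
  define d where "d n = f n - t * of_int (n * (n\<^sup>2 - 1))" for n
  have d_odd: "d (- n) = - d n" for n
    by (simp add: d_def odd power2_eq_square algebra_simps)
  have d_rec: "of_int (1 - n) * d (n + 1) + of_int (n + 2) * d n = 0" for n
    using rec[of 1 n] \<open>f 1 = 0\<close> odd[of 1] odd[of n]
    by (simp add: d_def power2_eq_square algebra_simps)
  have d0: "d 0 = 0" using d_odd[of 0] by simp
  have "d n = 0" if "n \<noteq> 0"
    using that
  proof (induction n rule: int_induct_from_two)
    case (up n)
    then have "of_int (1 - n) * d (n + 1) = 0" using d_rec[of n] by simp
    then show ?case using up by (simp del: of_int_diff)
  next
    case (down n)
    then have "of_int (1 - n) * d (n + 1) = 0" using d_rec[of n] d_odd[of n] by simp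
    then show ?case using down d_odd[of "n + 1"] by (simp del: of_int_diff)
  qed (use \<open>f 1 = 0\<close> d_odd[of 1] d_odd[of 2] f2 in \<open>auto simp: d_def power2_eq_square\<close>)
  with d0 have "d n = 0" by (cases "n = 0") auto
  then show ?thesis by (simp add: d_def t_def)
qed

context witt_extension
begin

lemma graded_form_lie_cocycle:
  assumes f: "\<And>n. f (- n) = - f n"
      "\<And>n m. of_int (m - n) * f (n + m) + of_int (- n - m - m) * f (- n) + of_int (n + n + m) * f (- m) = 0"
    and g: "mixed_cocycle g" and h: "\<And>n. h (- n) = - h n" "invariant_pairing h"
  shows "graded_form f g h \<in> lie_cocycles wscale br"
  unfolding graded_form_def
proof (rule antisym_form_lie_cocycle)
  fix n m k :: int
  have opp: "n + m = 0 \<Longrightarrow> m = - n" by simp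
  show "(if n + m = 0 then f n else 0) = - (if m + n = 0 then f m else 0)"
    "(if n + m = 0 then h n else 0) = - (if m + n = 0 then h m else 0)"
    by (auto simp: f(1) h(1) dest: opp)
  have sums: "(n + m + k = 0) = (k = - n - m)" "(m + k + n = 0) = (k = - n - m)"
    "(k + n + m = 0) = (k = - n - m)" "(n + (m + k) = 0) = (k = - n - m)"
    "(m + (n + k) = 0) = (k = - n - m)"
    by auto
  show "of_int (m - n) * (if n + m + k = 0 then f (n + m) else 0) +
      of_int (k - m) * (if m + k + n = 0 then f (m + k) else 0) +
      of_int (n - k) * (if k + n + m = 0 then f (k + n) else 0) = 0"
    using f(2)[of m n] unfolding sums by simp
  show "of_int (m - n) * (if n + m + k = 0 then g (n + m) else 0) -
      c m k * (if n + (m + k) = 0 then g n else 0) + c n k * (if m + (n + k) = 0 then g m else 0) = 0"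
    using g unfolding sums by (simp add: mixed_cocycle_def)
  show "c n m * (if n + m + k = 0 then h (n + m) else 0) +
      c n k * (if m + (n + k) = 0 then h m else 0) = 0"
    using h(2) unfolding sums by (simp add: invariant_pairing_def)
qed

lemma coboundary_on_basis:
  assumes "\<gamma> \<in> coboundaries wscale br"
  obtains \<phi> \<psi> where "\<And>n m. \<gamma> (eL n) (eL m) = of_int (m - n) * \<phi> (n + m)"
    "\<And>n m. \<gamma> (eL n) (eX m) = c n m * \<psi> (n + m)" "\<And>n m. \<gamma> (eX n) (eX m) = 0"
proof -
  obtain F where F: "Vector_Spaces.linear wscale (*) F" "\<gamma> = (\<lambda>x y. F (br x y))"
    using assms by (auto simp: coboundaries_def)
  interpret F: Vector_Spaces.linear wscale "(*)" F by (rule F(1))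
  show thesis
    by (rule that[of "\<lambda>n. F (eL n)" "\<lambda>n. F (eX n)"]) (simp_all add: F(2) F.scale F.zero del: of_int_diff)
qed

lemma functional_coboundary: "(\<lambda>x y. functional \<phi> \<psi> (br x y)) \<in> coboundaries wscale br"
  unfolding coboundaries_def
  by (intro CollectI exI conjI[rotated]) (auto intro: linear_functional)

text \<open>The coboundary of a multiple of the functional dual to \<open>X\<^sub>0\<close>: the one change by a coboundary of
  degree zero that affects the mixed component.\<close>

lemma graded_form_coboundary:
  "graded_form (\<lambda>_. 0) (\<lambda>n. s * c n (- n)) (\<lambda>_. 0) \<in> coboundaries wscale br"
proof -
  let ?\<psi> = "\<lambda>n :: int. if n = 0 then s else 0"
  let ?\<gamma> = "\<lambda>x y. functional (\<lambda>_. 0) ?\<psi> (br x y)"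
  interpret F: Vector_Spaces.linear wscale "(*)" "functional (\<lambda>_. 0) ?\<psi>" by (rule linear_functional)
  have "bilinear_form wscale ?\<gamma>"
    unfolding bilinear_form_wscale_iff by (simp add: br_linear F.add F.scale)
  then have "?\<gamma> = graded_form (\<lambda>_. 0) (\<lambda>n. s * c n (- n)) (\<lambda>_. 0)"
    unfolding graded_form_def
    by (rule bilinear_form_eqI[OF _ bilinear_antisym_form])
      (auto simp: F.scale F.neg F.zero add_eq_0_iff)
  then show ?thesis using functional_coboundary[of "\<lambda>_. 0" ?\<psi>] by simp
qed

text \<open>If \<open>\<alpha>(L\<^sub>0, u) = 0\<close> for all basis vectors \<open>u\<close> of nonzero degree, the cocycle identity with first
  argument \<open>L\<^sub>0\<close> says that \<open>\<alpha>\<close> is invariant under \<open>L\<^sub>0\<close> on pairs of nonzero total degree, so it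
  vanishes there. This condition is reached by subtracting the coboundary of
  \<open>u \<mapsto> \<alpha>(L\<^sub>0, u) / deg u\<close>. The value of the functional at \<open>L\<^sub>0\<close> is still free and is used to
  make \<open>\<alpha>(L\<^sub>-\<^sub>1, L\<^sub>1)\<close> zero.\<close>

lemma lie_cocycle_normal_form:
  assumes "\<alpha> \<in> lie_cocycles wscale br"
  obtains a g h where "mixed_cocycle g" "invariant_pairing h" "\<And>n. h (- n) = - h n"
    and "\<alpha> - graded_form (\<lambda>n. a * of_int (n * (n\<^sup>2 - 1))) g h \<in> coboundaries wscale br"
proof -
  define \<phi> where "\<phi> k = (if k = 0 then \<alpha> (eL (- 1)) (eL 1) / 2 else \<alpha> (eL 0) (eL k) / of_int k)" for k
  define \<psi> where "\<psi> k = \<alpha> (eL 0) (eX k) / of_int k" for k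
  define \<beta> where "\<beta> = \<alpha> - (\<lambda>x y. functional \<phi> \<psi> (br x y))"
  have F: "Vector_Spaces.linear wscale (*) (functional \<phi> \<psi>)" by (rule linear_functional)
  note cob = functional_coboundary[of \<phi> \<psi>]
  have \<beta>: "\<beta> \<in> lie_cocycles wscale br"
    unfolding \<beta>_def using coboundaries_subset_lie_cocycles cob
    by (intro forms.subspace_diff lie_cocycles_subspace assms) auto
  then have bil: "bilinear_form wscale \<beta>" and alt: "\<And>x. \<beta> x x = 0"
    and coc: "\<And>x y z. \<beta> (br x y) z + \<beta> (br y z) x + \<beta> (br z x) y = 0"
    by (simp_all only: lie_cocycles_def mem_Collect_eq)
  note b = bil[unfolded bilinear_form_wscale_iff] bilinear_form_neg[OF bil]
  have anti: "\<beta> x y = - \<beta> y x" for x y by (rule alternating_form_antisym[OF bil alt])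
  have F_scale: "functional \<phi> \<psi> (wscale a u) = a * functional \<phi> \<psi> u" for a u
    using F unfolding Vector_Spaces.linear_iff by blast
  have zero: "\<beta> 0 u = 0" "\<beta> u 0 = 0" for u
    using b(1) by (metis add_cancel_right_right)+
  have L0: "\<beta> (eL 0) (eL k) = 0" "k \<noteq> 0 \<Longrightarrow> \<beta> (eL 0) (eX k) = 0" for k
    using alt[of "eL 0"] by (cases "k = 0"; simp add: \<beta>_def F_scale \<phi>_def \<psi>_def weight)+
  have L1: "\<beta> (eL (- 1)) (eL 1) = 0"
    by (simp add: \<beta>_def F_scale \<phi>_def)
  have weight_zero: "\<beta> u v = 0"
    if "br (eL 0) u = wscale (of_int i) u" "br (eL 0) v = wscale (of_int j) v"
      "\<beta> (eL 0) (br u v) = 0" "i + j \<noteq> 0" for u v i j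
  proof -
    have "of_int i * \<beta> u v + \<beta> (br u v) (eL 0) + - of_int j * \<beta> v u = 0"
      using coc[of "eL 0" u v] by (simp only: that(1,2) br_antisym[of v "eL 0"] b mult_minus_left)
    then have "of_int (i + j) * \<beta> u v = 0"
      using that(3) anti[of "br u v" "eL 0"] anti[of v u] by (simp add: algebra_simps)
    then show ?thesis using that(4) by (simp del: of_int_add)
  qed
  define f where "f n = \<beta> (eL n) (eL (- n))" for n
  define g where "g n = \<beta> (eL n) (eX (- n))" for n
  define h where "h n = \<beta> (eX n) (eX (- n))" for n
  have opp: "n + m = 0 \<Longrightarrow> m = - n" for n m :: int by simp
  have LL: "\<beta> (eL n) (eL m) = (if n + m = 0 then f n else 0)" for n m
    using weight_zero[OF br_eL_0(1)[of n] br_eL_0(1)[of m]]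
    by (auto simp: f_def b L0 dest: opp)
  have LX: "\<beta> (eL n) (eX m) = (if n + m = 0 then g n else 0)" for n m
    using weight_zero[OF br_eL_0(1)[of n] br_eL_0(2)[of m]]
    by (auto simp: g_def b L0 dest: opp)
  have XX: "\<beta> (eX n) (eX m) = (if n + m = 0 then h n else 0)" for n m
    using weight_zero[OF br_eL_0(2)[of n] br_eL_0(2)[of m]]
    by (auto simp: h_def zero dest: opp)
  have XL: "\<beta> (eX m) (eL n) = - (if n + m = 0 then g n else 0)" for n m
    using anti[of "eX m" "eL n"] by (simp only: LX)
  have \<beta>_eq: "\<beta> = graded_form f g h"
    unfolding graded_form_def
    by (rule bilinear_form_eqI[OF bil bilinear_antisym_form]) (simp_all only: LL LX XL XX antisym_form_basis)
  have f: "f n = f 2 / 6 * of_int (n * (n\<^sup>2 - 1))" for n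
  proof (rule witt_cocycle_values)
    show odd: "f (- n) = - f n" for n using anti[of "eL (- n)" "eL n"] by (simp add: f_def)
    show "f 1 = 0" using L1 odd[of 1] by (simp add: f_def)
    fix n m
    show "of_int (m - n) * f (n + m) + of_int (- n - m - m) * f (- n) + of_int (n + n + m) * f (- m) = 0"
      using coc[of "eL n" "eL m" "eL (- n - m)"] by (simp add: b f_def)
  qed
  have f_eq: "(\<lambda>n. f 2 / 6 * of_int (n * (n\<^sup>2 - 1))) = f" by (intro ext) (rule f[symmetric])
  have g: "mixed_cocycle g"
    unfolding mixed_cocycle_def
  proof (intro allI)
    fix n m
    show "of_int (m - n) * g (n + m) - c m (- n - m) * g n + c n (- n - m) * g m = 0"
      using coc[of "eL n" "eL m" "eX (- n - m)"] by (simp add: b XL LX)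
  qed
  have h_odd: "h (- n) = - h n" for n using anti[of "eX (- n)" "eX n"] by (simp add: h_def)
  have h: "invariant_pairing h"
    unfolding invariant_pairing_def
  proof (intro allI)
    fix n m
    show "c n m * h (n + m) + c n (- n - m) * h m = 0"
      using coc[of "eL n" "eX m" "eX (- n - m)"] h_odd[of m] by (simp add: b zero XX)
  qed
  have "\<alpha> - graded_form (\<lambda>n. f 2 / 6 * of_int (n * (n\<^sup>2 - 1))) g h \<in> coboundaries wscale br"
    using cob by (simp only: f_eq \<beta>_eq[symmetric]) (simp add: \<beta>_def)
  with g h h_odd show thesis by (rule that)
qed

end

section \<open>Solutions of the recursions on A and B\<close>

definition coeff_A :: "P1 \<Rightarrow> int \<Rightarrow> int \<Rightarrow> complex" where
  "coeff_A lam n m = of_int (n + m) + (if m = 0 then lam_term lam n else 0)"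

definition coeff_B :: "P1 \<Rightarrow> int \<Rightarrow> int \<Rightarrow> complex" where
  "coeff_B lam n m = of_int m - (if n + m = 0 then lam_term lam n else 0)"

lemma W_A_eq: "W_A lam = extension_bracket (coeff_A lam)"
  by (simp add: W_A_def actA_def extension_bracket_def coeff_A_def)

lemma W_B_eq: "W_B lam = extension_bracket (coeff_B lam)"
  by (simp add: W_B_def actB_def extension_bracket_def coeff_B_def)

interpretation A: witt_extension "coeff_A lam" for lam
  by (rule witt_extension.intro) (simp_all add: lie_algebra_W_A coeff_A_def flip: W_A_eq)

interpretation B: witt_extension "coeff_B lam" for lam
  by (rule witt_extension.intro) (simp_all add: lie_algebra_W_B coeff_B_def flip: W_B_eq)

text \<open>Away from degree zero \<open>n h n\<close> is constant. The equation for \<open>m = 0\<close> carries the deformation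
  \<open>\<lambda>\<close>; it is used with an \<open>n\<close> for which \<open>n + n(n + 1)\<lambda>\<close> (or \<open>n + n\<^sup>2\<close> at infinity) is visibly
  nonzero, namely \<open>-1\<close> for finite \<open>\<lambda>\<close> and \<open>1\<close> at infinity.\<close>

lemma invariant_pairing_A:
  assumes "A.invariant_pairing lam h" and "m \<noteq> 0"
  shows "h m = 0"
proof -
  have inv: "coeff_A lam n k * h (n + k) + coeff_A lam n (- n - k) * h k = 0" for n k
    using assms(1) unfolding A.invariant_pairing_def by blast
  have rel: "h 1 = of_int k * h k" if "k \<noteq> 0" for k
    using inv[of "1 - k" k] that by (simp add: coeff_A_def)
  have "h 1 = 0"
  proof (cases lam)
    case (Fin l)
    then show ?thesis using inv[of "- 1" 0] rel[of "- 1"] by (simp add: coeff_A_def)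
  next
    case Infty
    then show ?thesis using inv[of 1 0] by (simp add: coeff_A_def)
  qed
  then show ?thesis using rel[OF assms(2)] assms(2) by simp
qed

lemma invariant_pairing_B:
  assumes "B.invariant_pairing lam h"
  shows "h m = of_int m * h 1"
proof -
  have inv: "coeff_B lam n k * h (n + k) + coeff_B lam n (- n - k) * h k = 0" for n k
    using assms(1) unfolding B.invariant_pairing_def by blast
  have "h 0 = 0"
  proof (cases lam)
    case (Fin l)
    then show ?thesis using inv[of "- 1" 0] by (simp add: coeff_B_def)
  next
    case Infty
    then show ?thesis using inv[of 1 0] by (simp add: coeff_B_def)
  qed
  moreover have "h m = of_int m * h 1" if "m \<noteq> 0"
    using inv[of "1 - m" m] that by (simp add: coeff_B_def)
  ultimately show ?thesis by (cases "m = 0") simp_all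
qed

text \<open>The equations with \<open>n\<close>, \<open>m\<close>, \<open>n + m\<close> all nonzero are independent of \<open>\<lambda>\<close> and are solved by affine
  functions; subtracting the one with the same values at \<open>1\<close> and \<open>2\<close> leaves zero. The equations
  with \<open>n + m = 0\<close> read \<open>g 0 = (l + 1) a - l b n\<^sup>2\<close>; comparing \<open>n = 1\<close> with \<open>n = 2\<close> gives \<open>l b = 0\<close>.
  At infinity they read \<open>g 0 = a - b n\<^sup>2\<close>.\<close>

lemma mixed_cocycle_A:
  assumes "A.mixed_cocycle lam g"
  obtains a b where "\<And>n. n \<noteq> 0 \<Longrightarrow> g n = a + b * of_int n"
    and "g 0 = (case lam of Fin l \<Rightarrow> (l + 1) * a | Infty \<Rightarrow> a)" and "lam = Fin 0 \<or> b = 0"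
proof -
  have coc: "of_int (m - n) * g (n + m) - coeff_A lam m (- n - m) * g n
      + coeff_A lam n (- n - m) * g m = 0" for n m
    using assms unfolding A.mixed_cocycle_def by blast
  define a b where "a = 2 * g 1 - g 2" and "b = g 2 - g 1"
  define d where "d n = g n - (a + b * of_int n)" for n
  have rec: "of_int (m - n) * d (n + m) + of_int n * d n - of_int m * d m = 0" if "n + m \<noteq> 0" for n m
    using coc[of m n] that by (simp add: coeff_A_def d_def algebra_simps)
  have base: "d 1 = 0" "d 2 = 0" by (simp_all add: d_def a_def b_def)
  have m1: "d (- 1) = 0" using rec[of 2 "- 1"] base by simp
  have "d n = 0" if "n \<noteq> 0" for n
    using that
  proof (induction n rule: int_induct_from_two)
    case minus_two
    show ?case using rec[of "- 2" 1] base m1 by simp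
  next
    case (up n)
    then have "of_int (1 - n) * d (n + 1) = 0" using rec[of n 1] base by simp
    then show ?case using up by (simp del: of_int_diff)
  next
    case (down n)
    then have "of_int (n - 1) * d (- n - 1) = 0" using rec[of "- n" "- 1"] m1 by simp
    then show ?case using down by (simp del: of_int_diff)
  qed (use base m1 in auto)
  then have g: "g n = a + b * of_int n" if "n \<noteq> 0" for n using that by (simp add: d_def)
  have "g 0 = (case lam of Fin l \<Rightarrow> (l + 1) * a | Infty \<Rightarrow> a) \<and> (lam = Fin 0 \<or> b = 0)"
  proof (cases lam)
    case (Fin l)
    have "2 * g 0 = 2 * ((l + 1) * a - l * b)" "4 * g 0 = 4 * ((l + 1) * a - 4 * (l * b))"
      using coc[of 1 "- 1"] coc[of 2 "- 2"] Fin
      by (simp_all add: coeff_A_def g algebra_simps)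
    then have "g 0 = (l + 1) * a - l * b" "g 0 = (l + 1) * a - 4 * (l * b)"
      unfolding mult_cancel_left by simp_all
    then show ?thesis using Fin by auto
  next
    case Infty
    have "2 * g 0 = 2 * (a - b)" "4 * g 0 = 4 * (a - 4 * b)"
      using coc[of 1 "- 1"] coc[of 2 "- 2"] Infty
      by (simp_all add: coeff_A_def g algebra_simps)
    then have "g 0 = a - b" "g 0 = a - 4 * b"
      unfolding mult_cancel_left by simp_all
    then show ?thesis using Infty by auto
  qed
  with g that show thesis by blast
qed

text \<open>Here the equations with \<open>n\<close> and \<open>m\<close> nonzero are solved by \<open>n\<close> and \<open>n\<^sup>2\<close>, and \<open>g 0 = 0\<close> comes from an
  equation with one of the indices zero.\<close>

lemma mixed_cocycle_B:
  assumes "B.mixed_cocycle lam g"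
  obtains a b where "\<And>n. g n = a * of_int n + b * of_int (n\<^sup>2)"
proof -
  have coc: "of_int (m - n) * g (n + m) - coeff_B lam m (- n - m) * g n
      + coeff_B lam n (- n - m) * g m = 0" for n m
    using assms unfolding B.mixed_cocycle_def by blast
  define b where "b = (g 2 - 2 * g 1) / 2"
  define a where "a = g 1 - b"
  have g2: "g 2 = 2 * a + 4 * b" by (simp add: a_def b_def field_simps)
  define d where "d n = g n - (a * of_int n + b * of_int (n\<^sup>2))" for n
  have rec: "of_int (m - n) * d (n + m) + of_int (n + m) * d n - of_int (n + m) * d m = 0"
    if "n \<noteq> 0" "m \<noteq> 0" for n m
    using coc[of m n] that by (simp add: coeff_B_def d_def power2_eq_square algebra_simps)
  have base: "d 1 = 0" "d 2 = 0" by (simp_all add: d_def a_def g2)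
  have m1: "d (- 1) = 0" using rec[of 2 "- 1"] base by simp
  have "d n = 0" if "n \<noteq> 0" for n
    using that
  proof (induction n rule: int_induct_from_two)
    case minus_two
    show ?case using rec[of "- 2" 1] base m1 by simp
  next
    case (up n)
    then have "of_int (1 - n) * d (n + 1) = 0" using rec[of n 1] base by simp
    then show ?case using up by (simp del: of_int_diff)
  next
    case (down n)
    then have "of_int (n - 1) * d (- n - 1) = 0" using rec[of "- n" "- 1"] m1 by simp
    then show ?case using down by (simp del: of_int_diff)
  qed (use base m1 in auto)
  moreover have "g 0 = 0"
  proof (cases lam)
    case (Fin l)
    then show ?thesis using coc[of "- 1" 0] by (simp add: coeff_B_def)
  next
    case Infty
    then show ?thesis using coc[of 1 0] by (simp add: coeff_B_def)
  qed
  then have "d 0 = 0" by (simp add: d_def)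
  ultimately have "d n = 0" for n by (cases "n = 0") simp_all
  then show thesis using that[of a b] by (simp add: d_def)
qed


section \<open>The given cocycles\<close>

lemma graded_form_add:
  "graded_form f g h + graded_form f' g' h' =
    graded_form (\<lambda>n. f n + f' n) (\<lambda>n. g n + g' n) (\<lambda>n. h n + h' n)"
proof -
  have "graded_form f g h + graded_form f' g' h' =
      (\<lambda>x y. 1 * graded_form f g h x y + 1 * graded_form f' g' h' x y)"
    by (simp add: fun_eq_iff)
  also have "\<dots> = graded_form (\<lambda>n. f n + f' n) (\<lambda>n. g n + g' n) (\<lambda>n. h n + h' n)"
    unfolding graded_form_def
    by (intro bilinear_form_eqI bilinear_antisym_form bilinear_form_combination[OF vector_space_wscale])
      simp_all
  finally show ?thesis .
qed

lemma graded_form_scale: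
  "form_scale s (graded_form f g h) = graded_form (\<lambda>n. s * f n) (\<lambda>n. s * g n) (\<lambda>n. s * h n)"
proof -
  have "form_scale s (graded_form f g h) = (\<lambda>x y. s * graded_form f g h x y + 0 * graded_form f g h x y)"
    by (simp add: form_scale_def)
  also have "\<dots> = graded_form (\<lambda>n. s * f n) (\<lambda>n. s * g n) (\<lambda>n. s * h n)"
    unfolding graded_form_def
    by (intro bilinear_form_eqI bilinear_antisym_form bilinear_form_combination[OF vector_space_wscale])
      simp_all
  finally show ?thesis .
qed

lemma Omega_Vir_graded:
  "Omega_Vir = graded_form (\<lambda>n. of_int (n * (n\<^sup>2 - 1)) / 12) (\<lambda>_. 0) (\<lambda>_. 0)"
  unfolding Omega_Vir_def graded_form_def
  by (rule bilinear_form_eqI) (simp_all add: bilinear_antisym_form)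

lemma Omega_A0_graded: "Omega_A0 = graded_form (\<lambda>_. 0) (\<lambda>n. of_int n) (\<lambda>_. 0)"
  unfolding Omega_A0_def graded_form_def
  by (rule bilinear_form_eqI) (simp_all add: bilinear_antisym_form)

lemma Omega_A_Mix_graded:
  "Omega_A_Mix lam = graded_form (\<lambda>_. 0)
     (\<lambda>n. case lam of Fin l \<Rightarrow> if n = 0 then l + 1 else 1 | Infty \<Rightarrow> 1) (\<lambda>_. 0)"
  unfolding Omega_A_Mix_def graded_form_def
  by (rule bilinear_form_eqI) (auto simp: bilinear_antisym_form split: P1.split)

lemma Omega_B_Ab_graded: "Omega_B_Ab = graded_form (\<lambda>_. 0) (\<lambda>_. 0) (\<lambda>n. of_int n)"
  unfolding Omega_B_Ab_def graded_form_def
  by (rule bilinear_form_eqI) (simp_all add: bilinear_antisym_form)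

lemma Omega_B_Mix_graded:
  "Omega_B_Mix lam = graded_form (\<lambda>_. 0)
     (\<lambda>n. if lam \<noteq> Fin 0 then of_int n else of_int (n * (n + 1))) (\<lambda>_. 0)"
  unfolding Omega_B_Mix_def graded_form_def
  by (rule bilinear_form_eqI) (simp_all add: bilinear_antisym_form)

lemma (in witt_extension) Omega_Vir_lie_cocycle: "Omega_Vir \<in> lie_cocycles wscale br"
  unfolding Omega_Vir_graded
proof (rule graded_form_lie_cocycle)
  fix n m :: int
  show "of_int (- n * ((- n)\<^sup>2 - 1)) / 12 = - (of_int (n * (n\<^sup>2 - 1)) / 12 :: complex)"
    by simp
  show "of_int (m - n) * (of_int ((n + m) * ((n + m)\<^sup>2 - 1)) / 12) +
      of_int (- n - m - m) * (of_int (- n * ((- n)\<^sup>2 - 1)) / 12) +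
      of_int (n + n + m) * (of_int (- m * ((- m)\<^sup>2 - 1)) / 12) = (0 :: complex)"
    by (simp add: power2_eq_square field_simps)
qed (simp_all add: mixed_cocycle_def invariant_pairing_def)

lemma Omega_A0_lie_cocycle: "Omega_A0 \<in> lie_cocycles wscale (extension_bracket (coeff_A (Fin 0)))"
  unfolding Omega_A0_graded
  by (rule A.graded_form_lie_cocycle)
    (simp_all add: A.mixed_cocycle_def A.invariant_pairing_def coeff_A_def algebra_simps)

lemma Omega_A_Mix_lie_cocycle:
  "Omega_A_Mix lam \<in> lie_cocycles wscale (extension_bracket (coeff_A lam))"
  unfolding Omega_A_Mix_graded
proof (rule A.graded_form_lie_cocycle)
  let ?g = "\<lambda>n. case lam of Fin l \<Rightarrow> if n = 0 then l + 1 else 1 | Infty \<Rightarrow> 1"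
  have "of_int (m - n) * ?g (n + m) - coeff_A lam m (- n - m) * ?g n
      + coeff_A lam n (- n - m) * ?g m = 0" for n m :: int
  proof (cases "n + m = 0")
    case True
    then have "m = - n" by simp
    then show ?thesis
      by (cases lam; cases "n = 0"; simp add: coeff_A_def algebra_simps power2_eq_square)
  next
    case False
    then have "- n - m \<noteq> 0" by simp
    with False show ?thesis
      by (cases lam; cases "n = 0"; cases "m = 0"; simp add: coeff_A_def)
  qed
  then show "A.mixed_cocycle lam ?g" unfolding A.mixed_cocycle_def by blast
qed (simp_all add: A.invariant_pairing_def)

lemma Omega_B_Ab_lie_cocycle:
  "Omega_B_Ab \<in> lie_cocycles wscale (extension_bracket (coeff_B lam))"
  unfolding Omega_B_Ab_graded
proof (rule B.graded_form_lie_cocycle)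
  have "coeff_B lam n m * of_int (n + m) + coeff_B lam n (- n - m) * of_int m = 0" for n m
  proof (cases "n + m = 0")
    case True
    then have "m = - n" by simp
    then show ?thesis by (cases "n = 0") (simp_all add: coeff_B_def)
  next
    case False
    then show ?thesis by (cases "m = 0") (simp_all add: coeff_B_def algebra_simps)
  qed
  then show "B.invariant_pairing lam (of_int)" unfolding B.invariant_pairing_def by blast
qed (simp_all add: B.mixed_cocycle_def)

lemma Omega_B_Mix_lie_cocycle:
  "Omega_B_Mix lam \<in> lie_cocycles wscale (extension_bracket (coeff_B lam))"
  unfolding Omega_B_Mix_graded
proof (rule B.graded_form_lie_cocycle)
  let ?g = "\<lambda>n. if lam \<noteq> Fin 0 then of_int n else of_int (n * (n + 1))"
  have "of_int (m - n) * ?g (n + m) - coeff_B lam m (- n - m) * ?g n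
      + coeff_B lam n (- n - m) * ?g m = 0" for n m :: int
    by (cases "n = 0"; cases "m = 0"; cases "lam = Fin 0") (simp_all add: coeff_B_def algebra_simps)
  then show "B.mixed_cocycle lam ?g" unfolding B.mixed_cocycle_def by blast
qed (simp_all add: B.invariant_pairing_def)


section \<open>Leibniz cocycles of the two algebras\<close>

lemma theta_A_basis [simp]:
  "theta_A (eL n) y = 0" "theta_A x (eL n) = 0"
  "theta_A (eX n) (eX m) = (if n = 0 \<and> m = 0 then 1 else 0)"
  by (simp_all add: theta_A_def eL_def eX_def vector_space_times)

lemma bilinear_theta_A: "bilinear_form wscale theta_A"
  unfolding bilinear_form_wscale_iff
  by (simp add: theta_A_def prod_scale_def bilinear_ext_linear algebra_simps)

text \<open>The component \<open>A\<^sub>0\<close> does not occur in any bracket: in \<open>[L\<^sub>n, A\<^sub>m]\<close> with \<open>n + m = 0\<close> the coefficient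
  is the deformation term \<open>n(n + 1)\<lambda>\<close> or \<open>n\<^sup>2\<close> supported on \<open>m = 0\<close>, hence on \<open>n = 0\<close>, where it vanishes.\<close>

lemma theta_A_bracket: "theta_A (extension_bracket (coeff_A lam) x y) z = 0"
proof -
  note b = bilinear_theta_A[unfolded bilinear_form_wscale_iff]
  have z: "bilinear_form wscale (\<lambda>_ _. 0)" by (simp add: bilinear_form_wscale_iff)
  have "bilinear_form wscale (\<lambda>x y. theta_A (extension_bracket (coeff_A lam) x y) z)"
    unfolding bilinear_form_wscale_iff by (simp add: b A.br_linear)
  moreover have "theta_A (wscale a (eX k)) z = 0" if "a = 0 \<or> k \<noteq> 0" for a k
  proof -
    have "theta_A (eX k) z = 0" if "k \<noteq> 0"
      using that by (simp add: theta_A_def eX_def bilinear_ext_def)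
    then show ?thesis using that by (auto simp: b)
  qed
  moreover have "coeff_A lam n m = 0 \<or> n + m \<noteq> 0" for n m
    by (cases "n + m = 0") (auto simp: coeff_A_def eq_neg_iff_add_eq_0[symmetric])
  moreover have "theta_A 0 z = 0" by (simp add: theta_A_def zero_prod_def)
  ultimately have "(\<lambda>x y. theta_A (extension_bracket (coeff_A lam) x y) z) = (\<lambda>_ _. 0)"
    by (intro bilinear_form_eqI[OF _ z]) (simp_all add: b A.bilinear_form_neg[OF bilinear_theta_A])
  from fun_cong[OF fun_cong[OF this, of x], of y] show ?thesis .
qed

lemma theta_A_sym: "theta_A u v = theta_A v u"
  unfolding theta_A_def by (subst bilinear_ext_flip) (simp add: conj_commute)

lemma theta_A_invariant:
  "invariant_symmetric_form wscale (extension_bracket (coeff_A lam)) theta_A"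
proof -
  have "theta_A u (extension_bracket (coeff_A lam) x v) = 0" for u x v
    by (subst theta_A_sym) (rule theta_A_bracket)
  then show ?thesis
    unfolding invariant_symmetric_form_def
    by (intro conjI allI bilinear_theta_A theta_A_sym) (simp only: theta_A_bracket add_0)
qed

lemma leibniz_cocycle_A_decomposition:
  assumes "\<alpha> \<in> leibniz_cocycles wscale (extension_bracket (coeff_A lam))"
  obtains t where "\<alpha> - form_scale t theta_A \<in> lie_cocycles wscale (extension_bracket (coeff_A lam))"
proof -
  define \<theta> where "\<theta> x y = \<alpha> x y + \<alpha> y x" for x y
  have \<theta>: "invariant_symmetric_form wscale (extension_bracket (coeff_A lam)) \<theta>"
    unfolding \<theta>_def by (rule A.leibniz_cocycle_symmetrization[OF assms])
  define t where "t = \<theta> (eX 0) (eX 0)"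
  have "coeff_A lam n (- 2 * n) \<noteq> 0" if "n \<noteq> 0" for n using that by (simp add: coeff_A_def)
  note zero = A.invariant_form_LL_LX[OF \<theta> this]
  have XX: "\<theta> (eX n) (eX m) = (if n = 0 \<and> m = 0 then t else 0)" for n m
  proof (cases "n + m = 0")
    case True
    then have "m = - n" by simp
    then show ?thesis
      using invariant_pairing_A[OF A.invariant_form_XX(2)[OF \<theta>], of n] by (auto simp: t_def)
  next
    case False
    then show ?thesis using A.invariant_form_XX(1)[OF \<theta>] by auto
  qed
  have "\<theta> = (\<lambda>x y. t * theta_A x y + 0 * theta_A x y)"
    by (rule bilinear_form_eqI[OF invariant_symmetric_formD(1)[OF \<theta>]
          bilinear_form_combination[OF vector_space_wscale bilinear_theta_A bilinear_theta_A]])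
      (simp_all add: zero XX invariant_symmetric_formD(2)[OF \<theta>, of "eX _" "eL _"])
  then have \<theta>_eq: "\<theta> x x = t * theta_A x x" for x
    using fun_cong[OF fun_cong, of \<theta> _ x x] by simp
  have "\<alpha> x x = t / 2 * theta_A x x" for x
    using \<theta>_eq[of x] by (simp add: \<theta>_def field_simps)
  moreover have "theta_A \<in> leibniz_cocycles wscale (extension_bracket (coeff_A lam))"
    by (rule A.invariant_form_leibniz_cocycle[OF theta_A_invariant theta_A_bracket])
  then have "\<alpha> - form_scale (t / 2) theta_A \<in> leibniz_cocycles wscale (extension_bracket (coeff_A lam))"
    by (intro forms.subspace_diff forms.subspace_scale leibniz_cocycles_subspace vector_space_wscale assms)
  ultimately have "\<alpha> - form_scale (t / 2) theta_A \<in> lie_cocycles wscale (extension_bracket (coeff_A lam))"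
    unfolding A.lie_cocycles_eq by (simp add: form_scale_def)
  then show thesis by (rule that)
qed

text \<open>A symmetric invariant form restricted to B has values \<open>h n = n h 1\<close>, which is odd in \<open>n\<close>, while
  symmetry makes it even.\<close>

lemma leibniz_cocycles_B:
  "leibniz_cocycles wscale (extension_bracket (coeff_B lam)) =
    lie_cocycles wscale (extension_bracket (coeff_B lam))"
proof -
  have "\<alpha> x x = 0" if \<alpha>: "\<alpha> \<in> leibniz_cocycles wscale (extension_bracket (coeff_B lam))" for \<alpha> x
  proof -
    define \<theta> where "\<theta> x y = \<alpha> x y + \<alpha> y x" for x y
    have \<theta>: "invariant_symmetric_form wscale (extension_bracket (coeff_B lam)) \<theta>"
      unfolding \<theta>_def by (rule B.leibniz_cocycle_symmetrization[OF \<alpha>])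
    have "coeff_B lam n (- 2 * n) \<noteq> 0" if "n \<noteq> 0" for n using that by (simp add: coeff_B_def)
    note zero = B.invariant_form_LL_LX[OF \<theta> this]
    have h: "\<theta> (eX n) (eX (- n)) = of_int n * \<theta> (eX 1) (eX (- 1))" for n
      using invariant_pairing_B[OF B.invariant_form_XX(2)[OF \<theta>], of n] by simp
    have "\<theta> (eX 1) (eX (- 1)) = 0"
      using h[of "- 1"] invariant_symmetric_formD(2)[OF \<theta>, of "eX 1" "eX (- 1)"] by simp
    with h have diag: "\<theta> (eX n) (eX (- n)) = 0" for n by simp
    have XX: "\<theta> (eX n) (eX m) = 0" for n m
    proof (cases "n + m = 0")
      case True
      then have "m = - n" by simp
      then show ?thesis using diag by simp
    next
      case False
      then show ?thesis by (rule B.invariant_form_XX(1)[OF \<theta>])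
    qed
    have "\<theta> = (\<lambda>_ _. 0)"
      by (rule bilinear_form_eqI[OF invariant_symmetric_formD(1)[OF \<theta>]])
        (simp_all add: bilinear_form_wscale_iff zero XX invariant_symmetric_formD(2)[OF \<theta>, of "eX _" "eL _"])
    from fun_cong[OF fun_cong[OF this, of x], of x] show ?thesis by (simp add: \<theta>_def)
  qed
  then show ?thesis unfolding B.lie_cocycles_eq by blast
qed

section \<open>Lie cocycles modulo coboundaries\<close>

lemma lie_cocycle_A_decomposition:
  assumes "\<alpha> \<in> lie_cocycles wscale (extension_bracket (coeff_A lam))"
  obtains x y z where "lam = Fin 0 \<or> y = 0"
    and "\<alpha> - (form_scale x Omega_Vir + (form_scale y Omega_A0 + form_scale z (Omega_A_Mix lam)))
      \<in> coboundaries wscale (extension_bracket (coeff_A lam))"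
proof -
  obtain a g h
    where g: "A.mixed_cocycle lam g" and h: "A.invariant_pairing lam h" "\<And>n. h (- n) = - h n"
      and N: "\<alpha> - graded_form (\<lambda>n. a * of_int (n * (n\<^sup>2 - 1))) g h
        \<in> coboundaries wscale (extension_bracket (coeff_A lam))"
    by (rule A.lie_cocycle_normal_form[OF assms], rule that)
  obtain z y where g':
    "\<And>n. n \<noteq> 0 \<Longrightarrow> g n = z + y * of_int n"
    "g 0 = (case lam of Fin l \<Rightarrow> (l + 1) * z | Infty \<Rightarrow> z)" "lam = Fin 0 \<or> y = 0"
    by (rule mixed_cocycle_A[OF g], rule that)
  have "g = (\<lambda>n. y * of_int n + z * (case lam of Fin l \<Rightarrow> if n = 0 then l + 1 else 1 | Infty \<Rightarrow> 1))"
  proof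
    fix n
    show "g n = y * of_int n + z * (case lam of Fin l \<Rightarrow> if n = 0 then l + 1 else 1 | Infty \<Rightarrow> 1)"
      by (cases "n = 0") (simp_all add: g' mult.commute split: P1.split)
  qed
  moreover have "h = (\<lambda>_. 0)"
  proof
    show "h n = 0" for n
      using invariant_pairing_A[OF h(1)] h(2)[of 0] by (cases "n = 0") auto
  qed
  ultimately have "graded_form (\<lambda>n. a * of_int (n * (n\<^sup>2 - 1))) g h =
      form_scale (12 * a) Omega_Vir + (form_scale y Omega_A0 + form_scale z (Omega_A_Mix lam))"
    by (simp add: Omega_Vir_graded Omega_A0_graded Omega_A_Mix_graded graded_form_scale graded_form_add)
  with N show thesis by (intro that[OF g'(3)]) (simp only:)
qed

text \<open>The solution \<open>a n + b n\<^sup>2\<close> of the mixed recursion is rewritten in terms of the chosen cocycle and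
  the coboundary coefficients \<open>-n - n(n + 1)\<lambda>\<close> (or \<open>-n - n\<^sup>2\<close> at infinity). The coefficients below
  come from comparing first \<open>n\<^sup>2\<close> and then \<open>n\<close>.\<close>

lemma lie_cocycle_B_decomposition:
  assumes "\<alpha> \<in> lie_cocycles wscale (extension_bracket (coeff_B lam))"
  obtains x y z where
    "\<alpha> - (form_scale x Omega_Vir + (form_scale y Omega_B_Ab + form_scale z (Omega_B_Mix lam)))
      \<in> coboundaries wscale (extension_bracket (coeff_B lam))"
proof -
  let ?N = "coboundaries wscale (extension_bracket (coeff_B lam))"
  obtain x g h
    where g: "B.mixed_cocycle lam g" and h: "B.invariant_pairing lam h" "\<And>n. h (- n) = - h n"
      and N: "\<alpha> - graded_form (\<lambda>n. x * of_int (n * (n\<^sup>2 - 1))) g h \<in> ?N"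
    by (rule B.lie_cocycle_normal_form[OF assms], rule that)
  obtain a b where ab: "\<And>n. g n = a * of_int n + b * of_int (n\<^sup>2)"
    by (rule mixed_cocycle_B[OF g], rule that)
  let ?mix = "\<lambda>n. if lam \<noteq> Fin 0 then of_int n else of_int (n * (n + 1)) :: complex"
  have "\<exists>z s. \<forall>n. g n = z * ?mix n + s * coeff_B lam n (- n)"
  proof (cases lam)
    case (Fin l)
    show ?thesis
    proof (cases "l = 0")
      case True
      with Fin show ?thesis
        by (intro exI[of _ b] exI[of _ "b - a"])
          (simp add: ab coeff_B_def algebra_simps power2_eq_square)
    next
      case False
      with Fin show ?thesis
        by (intro exI[of _ "a - b / l * (1 + l)"] exI[of _ "- b / l"])
          (simp add: ab coeff_B_def field_simps power2_eq_square)
    qed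
  next
    case Infty
    then show ?thesis
      by (intro exI[of _ "a - b"] exI[of _ "- b"])
        (simp add: ab coeff_B_def algebra_simps power2_eq_square)
  qed
  then obtain z s where zs: "\<forall>n. g n = z * ?mix n + s * coeff_B lam n (- n)" by (elim exE)
  have "g = (\<lambda>n. z * ?mix n + s * coeff_B lam n (- n))"
    by (rule ext) (rule zs[THEN spec])
  moreover obtain y where "h = (\<lambda>n. y * of_int n)"
  proof
    show "h = (\<lambda>n. h 1 * of_int n)"
      by (rule ext) (subst mult.commute, rule invariant_pairing_B[OF h(1)])
  qed
  ultimately have "graded_form (\<lambda>n. x * of_int (n * (n\<^sup>2 - 1))) g h =
      form_scale (12 * x) Omega_Vir + (form_scale y Omega_B_Ab + form_scale z (Omega_B_Mix lam))
      + graded_form (\<lambda>_. 0) (\<lambda>n. s * coeff_B lam n (- n)) (\<lambda>_. 0)"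
    by (simp add: Omega_Vir_graded Omega_B_Ab_graded Omega_B_Mix_graded graded_form_scale graded_form_add)
  with N have "\<alpha> - (form_scale (12 * x) Omega_Vir +
      (form_scale y Omega_B_Ab + form_scale z (Omega_B_Mix lam)))
      - graded_form (\<lambda>_. 0) (\<lambda>n. s * coeff_B lam n (- n)) (\<lambda>_. 0) \<in> ?N" (is "?\<beta> - ?\<gamma> \<in> ?N")
    by (simp only: diff_diff_add)
  then have "?\<beta> - ?\<gamma> + ?\<gamma> \<in> ?N"
    by (rule forms.subspace_add[OF coboundaries_subspace[OF vector_space_wscale]
          _ B.graded_form_coboundary])
  then have "?\<beta> \<in> ?N" by (simp only: diff_add_cancel)
  then show thesis by (rule that)
qed

text \<open>The structure constant of \<open>[L\<^sub>n, A\<^sub>-\<^sub>n]\<close> is zero, so on these pairs every coboundary vanishes and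
  the combination can be evaluated at \<open>n = 1\<close> and \<open>n = -1\<close>.\<close>

lemma independent_A:
  assumes "form_scale x Omega_Vir + (form_scale y Omega_A0 + form_scale z (Omega_A_Mix lam))
      \<in> coboundaries wscale (extension_bracket (coeff_A lam))"
  shows "x = 0" "y = 0" "z = 0"
proof -
  obtain \<phi> \<psi> where
    LL: "\<And>n m. (form_scale x Omega_Vir + (form_scale y Omega_A0 + form_scale z (Omega_A_Mix lam)))
      (eL n) (eL m) = of_int (m - n) * \<phi> (n + m)" and
    LX: "\<And>n m. (form_scale x Omega_Vir + (form_scale y Omega_A0 + form_scale z (Omega_A_Mix lam)))
      (eL n) (eX m) = coeff_A lam n m * \<psi> (n + m)" and
    XX: "\<And>n m. (form_scale x Omega_Vir + (form_scale y Omega_A0 + form_scale z (Omega_A_Mix lam)))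
      (eX n) (eX m) = 0"
    by (rule A.coboundary_on_basis[OF assms], rule that)
  note defs = form_scale_def Omega_Vir_def Omega_A0_def Omega_A_Mix_def coeff_A_def
  have "\<phi> 0 = 0" using LL[of 1 "- 1"] by (simp add: defs)
  then show "x = 0" using LL[of 2 "- 2"] by (simp add: defs)
  have "z + y = 0" "z - y = 0"
    using LX[of 1 "- 1"] LX[of "- 1" 1] by (simp_all add: defs split: P1.splits)
  then have "z = y" "y + y = 0" by simp_all
  then show "y = 0" "z = 0" by simp_all
qed

lemma independent_B:
  assumes "form_scale x Omega_Vir + (form_scale y Omega_B_Ab + form_scale z (Omega_B_Mix lam))
      \<in> coboundaries wscale (extension_bracket (coeff_B lam))"
  shows "x = 0" "y = 0" "z = 0"
proof -
  obtain \<phi> \<psi> where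
    LL: "\<And>n m. (form_scale x Omega_Vir + (form_scale y Omega_B_Ab + form_scale z (Omega_B_Mix lam)))
      (eL n) (eL m) = of_int (m - n) * \<phi> (n + m)" and
    LX: "\<And>n m. (form_scale x Omega_Vir + (form_scale y Omega_B_Ab + form_scale z (Omega_B_Mix lam)))
      (eL n) (eX m) = coeff_B lam n m * \<psi> (n + m)" and
    XX: "\<And>n m. (form_scale x Omega_Vir + (form_scale y Omega_B_Ab + form_scale z (Omega_B_Mix lam)))
      (eX n) (eX m) = 0"
    by (rule B.coboundary_on_basis[OF assms], rule that)
  note defs = form_scale_def Omega_Vir_def Omega_B_Ab_def Omega_B_Mix_def coeff_B_def
  have "\<phi> 0 = 0" using LL[of 1 "- 1"] by (simp add: defs)
  then show "x = 0" using LL[of 2 "- 2"] by (simp add: defs)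
  show "y = 0" using XX[of 1 "- 1"] by (simp add: defs)
  show "z = 0"
  proof (cases lam)
    case (Fin l)
    show ?thesis
    proof (cases "l = 0")
      case True
      with Fin show ?thesis using LX[of 1 "- 1"] LX[of "- 1" 1] by (simp add: defs)
    next
      case False
      have "\<psi> 0 = - z" "z + 2 * l * \<psi> 0 = - \<psi> 0"
        using LX[of 1 "- 1"] LX[of "- 1" 1] Fin False by (auto simp: defs algebra_simps)
      with False show ?thesis by simp
    qed
  next
    case Infty
    then show ?thesis
      using LX[of 1 "- 1"] LX[of "- 1" 1] by (simp add: defs)
  qed
qed

section \<open>The cohomology spaces\<close>

lemma
  assumes "lam = Fin 0"
  shows H2_A_zero: "internal_direct_sum (bd_A lam) (H2 wscale (W_A lam))
      [line_A lam Omega_Vir, line_A lam Omega_A0, line_A lam (Omega_A_Mix lam)]"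
    and lines_A_zero: "\<alpha> \<in> {Omega_Vir, Omega_A0, Omega_A_Mix lam} \<Longrightarrow>
      one_dimensional (bd_A lam) (line_A lam \<alpha>)"
proof -
  let ?\<Omega> = "[Omega_Vir, Omega_A0, Omega_A_Mix lam]" and ?N = "bd_A lam"
  let ?Z = "lie_cocycles wscale (W_A lam)"
  have ne: "?\<Omega> \<noteq> []" by simp
  have Z: "forms.subspace ?Z" unfolding W_A_eq by (rule A.lie_cocycles_subspace)
  have sub: "set ?\<Omega> \<subseteq> ?Z"
    using A.Omega_Vir_lie_cocycle[of lam] Omega_A0_lie_cocycle Omega_A_Mix_lie_cocycle[of lam]
    by (simp add: W_A_eq assms)
  have span: "\<exists>cs. length cs = length ?\<Omega> \<and> \<alpha> - sum_list (map2 form_scale cs ?\<Omega>) \<in> ?N"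
    if "\<alpha> \<in> ?Z" for \<alpha>
  proof -
    have \<alpha>: "\<alpha> \<in> lie_cocycles wscale (extension_bracket (coeff_A lam))"
      using that by (simp only: W_A_eq)
    obtain x y z where "lam = Fin 0 \<or> y = 0" and "\<alpha> - (form_scale x Omega_Vir +
        (form_scale y Omega_A0 + form_scale z (Omega_A_Mix lam))) \<in> ?N"
      unfolding W_A_eq by (rule lie_cocycle_A_decomposition[OF \<alpha>])
    then show ?thesis by (intro exI[of _ "[x, y, z]"]) simp
  qed
  have indep: "set cs \<subseteq> {0}"
    if len: "length cs = length ?\<Omega>" and N: "sum_list (map2 form_scale cs ?\<Omega>) \<in> ?N" for cs
  proof -
    obtain x y z where cs: "cs = [x, y, z]"
      using len by (auto simp: length_Suc_conv)
    then show ?thesis using N independent_A[of x y z lam] by (simp add: W_A_eq)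
  qed
  show "internal_direct_sum ?N (H2 wscale (W_A lam))
      [line_A lam Omega_Vir, line_A lam Omega_A0, line_A lam (Omega_A_Mix lam)]"
    using internal_direct_sum_lines[OF vector_space_wscale ne Z sub span indep]
    by (simp add: H2_def)
  show "one_dimensional ?N (line_A lam \<alpha>)" if "\<alpha> \<in> {Omega_Vir, Omega_A0, Omega_A_Mix lam}"
    using one_dimensional_lines[OF vector_space_wscale ne Z sub span indep] that by simp
qed

lemma
  assumes "lam \<noteq> Fin 0"
  shows H2_A_nonzero: "internal_direct_sum (bd_A lam) (H2 wscale (W_A lam))
      [line_A lam Omega_Vir, line_A lam (Omega_A_Mix lam)]"
    and lines_A_nonzero: "\<alpha> \<in> {Omega_Vir, Omega_A_Mix lam} \<Longrightarrow>
      one_dimensional (bd_A lam) (line_A lam \<alpha>)"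
proof -
  let ?\<Omega> = "[Omega_Vir, Omega_A_Mix lam]" and ?N = "bd_A lam"
  let ?Z = "lie_cocycles wscale (W_A lam)"
  have ne: "?\<Omega> \<noteq> []" by simp
  have Z: "forms.subspace ?Z" unfolding W_A_eq by (rule A.lie_cocycles_subspace)
  have sub: "set ?\<Omega> \<subseteq> ?Z"
    using A.Omega_Vir_lie_cocycle[of lam] Omega_A_Mix_lie_cocycle[of lam]
    by (simp add: W_A_eq)
  have span: "\<exists>cs. length cs = length ?\<Omega> \<and> \<alpha> - sum_list (map2 form_scale cs ?\<Omega>) \<in> ?N"
    if "\<alpha> \<in> ?Z" for \<alpha>
  proof -
    have \<alpha>: "\<alpha> \<in> lie_cocycles wscale (extension_bracket (coeff_A lam))"
      using that by (simp only: W_A_eq)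
    obtain x y z where "lam = Fin 0 \<or> y = 0" and "\<alpha> - (form_scale x Omega_Vir +
        (form_scale y Omega_A0 + form_scale z (Omega_A_Mix lam))) \<in> ?N"
      unfolding W_A_eq by (rule lie_cocycle_A_decomposition[OF \<alpha>])
    then have "\<alpha> - (form_scale x Omega_Vir +
        (form_scale 0 Omega_A0 + form_scale z (Omega_A_Mix lam))) \<in> ?N"
      using assms by simp
    then show ?thesis by (intro exI[of _ "[x, z]"]) simp
  qed
  have indep: "set cs \<subseteq> {0}"
    if len: "length cs = length ?\<Omega>" and N: "sum_list (map2 form_scale cs ?\<Omega>) \<in> ?N" for cs
  proof -
    obtain x z where cs: "cs = [x, z]"
      using len by (auto simp: length_Suc_conv)
    then show ?thesis using N independent_A[of x 0 z lam] by (simp add: W_A_eq)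
  qed
  show "internal_direct_sum ?N (H2 wscale (W_A lam))
      [line_A lam Omega_Vir, line_A lam (Omega_A_Mix lam)]"
    using internal_direct_sum_lines[OF vector_space_wscale ne Z sub span indep]
    by (simp add: H2_def)
  show "one_dimensional ?N (line_A lam \<alpha>)" if "\<alpha> \<in> {Omega_Vir, Omega_A_Mix lam}"
    using one_dimensional_lines[OF vector_space_wscale ne Z sub span indep] that by simp
qed

lemma
  shows H2_B: "internal_direct_sum (bd_B lam) (H2 wscale (W_B lam))
      [line_B lam Omega_Vir, line_B lam Omega_B_Ab, line_B lam (Omega_B_Mix lam)]"
    and lines_B: "\<alpha> \<in> {Omega_Vir, Omega_B_Ab, Omega_B_Mix lam} \<Longrightarrow>
      one_dimensional (bd_B lam) (line_B lam \<alpha>)"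
proof -
  let ?\<Omega> = "[Omega_Vir, Omega_B_Ab, Omega_B_Mix lam]" and ?N = "bd_B lam"
  let ?Z = "lie_cocycles wscale (W_B lam)"
  have ne: "?\<Omega> \<noteq> []" by simp
  have Z: "forms.subspace ?Z" unfolding W_B_eq by (rule B.lie_cocycles_subspace)
  have sub: "set ?\<Omega> \<subseteq> ?Z"
    using B.Omega_Vir_lie_cocycle[of lam] Omega_B_Ab_lie_cocycle[of lam] Omega_B_Mix_lie_cocycle[of lam]
    by (simp add: W_B_eq)
  have span: "\<exists>cs. length cs = length ?\<Omega> \<and> \<alpha> - sum_list (map2 form_scale cs ?\<Omega>) \<in> ?N"
    if "\<alpha> \<in> ?Z" for \<alpha>
  proof -
    have \<alpha>: "\<alpha> \<in> lie_cocycles wscale (extension_bracket (coeff_B lam))"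
      using that by (simp only: W_B_eq)
    obtain x y z where "\<alpha> - (form_scale x Omega_Vir +
        (form_scale y Omega_B_Ab + form_scale z (Omega_B_Mix lam))) \<in> ?N"
      unfolding W_B_eq by (rule lie_cocycle_B_decomposition[OF \<alpha>])
    then show ?thesis by (intro exI[of _ "[x, y, z]"]) simp
  qed
  have indep: "set cs \<subseteq> {0}"
    if len: "length cs = length ?\<Omega>" and N: "sum_list (map2 form_scale cs ?\<Omega>) \<in> ?N" for cs
  proof -
    obtain x y z where cs: "cs = [x, y, z]"
      using len by (auto simp: length_Suc_conv)
    then show ?thesis using N independent_B[of x y z lam] by (simp add: W_B_eq)
  qed
  show "internal_direct_sum ?N (H2 wscale (W_B lam))
      [line_B lam Omega_Vir, line_B lam Omega_B_Ab, line_B lam (Omega_B_Mix lam)]"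
    using internal_direct_sum_lines[OF vector_space_wscale ne Z sub span indep]
    by (simp add: H2_def)
  show "one_dimensional ?N (line_B lam \<alpha>)" if "\<alpha> \<in> {Omega_Vir, Omega_B_Ab, Omega_B_Mix lam}"
    using one_dimensional_lines[OF vector_space_wscale ne Z sub span indep] that by simp
qed

lemma theta_A_leibniz_cocycle: "theta_A \<in> leibniz_cocycles wscale (W_A lam)"
  unfolding W_A_eq by (rule A.invariant_form_leibniz_cocycle[OF theta_A_invariant theta_A_bracket])

text \<open>On the pair \<open>(A\<^sub>0, A\<^sub>0)\<close> alternating forms and coboundaries vanish, and \<open>\<theta>\<^sub>A\<close> does not.\<close>

lemma lie_cocycle_plus_theta_A:
  assumes "\<alpha> \<in> lie_cocycles wscale (W_A lam)" and "\<alpha> + form_scale t theta_A \<in> bd_A lam"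
  shows "t = 0" "\<alpha> \<in> bd_A lam"
proof -
  have "(\<alpha> + form_scale t theta_A) (eX 0) (eX 0) = 0"
    by (rule A.coboundary_on_basis[OF assms(2)[unfolded W_A_eq]])
  moreover have "\<alpha> (eX 0) (eX 0) = 0"
    using assms(1) unfolding lie_cocycles_def by blast
  ultimately show "t = 0" by (simp add: form_scale_def)
  with assms(2) show "\<alpha> \<in> bd_A lam" by simp
qed

lemma theta_A_class_nonzero: "cohom_class wscale (W_A lam) theta_A \<noteq> bd_A lam"
proof
  assume "cohom_class wscale (W_A lam) theta_A = bd_A lam"
  then have "theta_A \<in> bd_A lam"
    using cohom_class_eq_iff[OF vector_space_wscale, of "W_A lam" theta_A 0]
      cohom_class_0[OF vector_space_wscale, of "W_A lam"] by simp
  moreover have "0 \<in> lie_cocycles wscale (W_A lam)"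
    unfolding W_A_eq by (rule forms.subspace_0[OF A.lie_cocycles_subspace])
  ultimately show False using lie_cocycle_plus_theta_A(1)[of 0 lam 1] by simp
qed

lemma HL2_A: "internal_direct_sum (bd_A lam) (HL2 wscale (W_A lam))
    [H2 wscale (W_A lam), line_A lam theta_A]"
proof -
  let ?Vs = "[lie_cocycles wscale (W_A lam), forms.span {theta_A}]"
  let ?Z = "leibniz_cocycles wscale (W_A lam)"
  have Z: "forms.subspace ?Z" by (rule leibniz_cocycles_subspace[OF vector_space_wscale])
  have "internal_direct_sum (bd_A lam) (cohom_class wscale (W_A lam) ` ?Z)
      (map ((`) (cohom_class wscale (W_A lam))) ?Vs)"
  proof (rule internal_direct_sum_images[OF vector_space_wscale _ Z])
    show "?Vs \<noteq> []" by simp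
    fix V assume "V \<in> set ?Vs"
    moreover have "forms.subspace (lie_cocycles wscale (W_A lam))"
      "lie_cocycles wscale (W_A lam) \<subseteq> ?Z"
      unfolding W_A_eq by (rule A.lie_cocycles_subspace) (auto simp: A.lie_cocycles_eq)
    moreover have "forms.span {theta_A} \<subseteq> ?Z"
      using theta_A_leibniz_cocycle Z by (intro forms.span_minimal) simp_all
    ultimately show "forms.subspace V \<and> V \<subseteq> ?Z"
      using forms.subspace_span[of "{theta_A}"] by auto
  next
    fix \<gamma> assume "\<gamma> \<in> ?Z"
    then obtain t where "\<gamma> - form_scale t theta_A \<in> lie_cocycles wscale (W_A lam)"
      unfolding W_A_eq by (rule leibniz_cocycle_A_decomposition)
    then have "[\<gamma> - form_scale t theta_A, form_scale t theta_A] \<in> listset ?Vs"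
      unfolding in_listset_iff by (auto simp: forms.span_singleton)
    moreover have "\<gamma> - sum_list [\<gamma> - form_scale t theta_A, form_scale t theta_A] \<in> bd_A lam"
      using forms.subspace_0[OF coboundaries_subspace[OF vector_space_wscale, of "W_A lam"]]
      by (simp only: sum_list.Cons sum_list.Nil add_0_right diff_add_cancel diff_self)
    ultimately show "\<exists>vs\<in>listset ?Vs. \<gamma> - sum_list vs \<in> bd_A lam" by blast
  next
    fix vs assume vs: "vs \<in> listset ?Vs" "sum_list vs \<in> bd_A lam"
    then obtain \<alpha> t where eq: "vs = [\<alpha>, form_scale t theta_A]" and \<alpha>: "\<alpha> \<in> lie_cocycles wscale (W_A lam)"
      unfolding in_listset_iff by (auto simp: forms.span_singleton list_all2_Cons2)
    then have "t = 0" "\<alpha> \<in> bd_A lam"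
      using lie_cocycle_plus_theta_A[OF \<alpha>, of t] vs(2) by simp_all
    then show "set vs \<subseteq> bd_A lam"
      using forms.subspace_0[OF coboundaries_subspace[OF vector_space_wscale, of "W_A lam"]]
      by (simp add: eq)
  qed
  then show ?thesis
    by (simp add: HL2_def H2_def class_line_eq[OF vector_space_wscale])
qed

theorem theorem1p1:
  fixes lam :: P1
  shows
    "(lam = Fin 0 \<longrightarrow>
        internal_direct_sum (bd_A lam) (H2 wscale (W_A lam))
          [line_A lam Omega_Vir, line_A lam Omega_A0, line_A lam (Omega_A_Mix lam)] \<and>
        one_dimensional (bd_A lam) (line_A lam Omega_Vir) \<and>
        one_dimensional (bd_A lam) (line_A lam Omega_A0) \<and>
        one_dimensional (bd_A lam) (line_A lam (Omega_A_Mix lam))) \<and>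
     (lam \<noteq> Fin 0 \<longrightarrow>
        internal_direct_sum (bd_A lam) (H2 wscale (W_A lam))
          [line_A lam Omega_Vir, line_A lam (Omega_A_Mix lam)] \<and>
        one_dimensional (bd_A lam) (line_A lam Omega_Vir) \<and>
        one_dimensional (bd_A lam) (line_A lam (Omega_A_Mix lam))) \<and>
     (internal_direct_sum (bd_B lam) (H2 wscale (W_B lam))
        [line_B lam Omega_Vir, line_B lam Omega_B_Ab, line_B lam (Omega_B_Mix lam)] \<and>
      one_dimensional (bd_B lam) (line_B lam Omega_Vir) \<and>
      one_dimensional (bd_B lam) (line_B lam Omega_B_Ab) \<and>
      one_dimensional (bd_B lam) (line_B lam (Omega_B_Mix lam))) \<and>
     (invariant_symmetric_form wscale (W_A lam) theta_A \<and>
      theta_A \<in> leibniz_cocycles wscale (W_A lam) \<and>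
      cohom_class wscale (W_A lam) theta_A \<noteq> bd_A lam \<and>
      internal_direct_sum (bd_A lam) (HL2 wscale (W_A lam))
        [H2 wscale (W_A lam), line_A lam theta_A]) \<and>
     HL2 wscale (W_B lam) = H2 wscale (W_B lam)"
  using H2_A_zero lines_A_zero H2_A_nonzero lines_A_nonzero H2_B lines_B theta_A_invariant
    theta_A_leibniz_cocycle theta_A_class_nonzero HL2_A
  by (simp add: HL2_def H2_def W_A_eq W_B_eq leibniz_cocycles_B)

end
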